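(* Let $(q,p),(q',p')\in\mathcal Q$ with $p'\neq p$, and let $\mu^+_{p/q}$, $\mu^-_{p/q}$ be as defined in the context. If $q'<q$ and $\dfrac{q'-q}{p'-p}\le\mu^+_{p/q}$, then $(q,p)\prec_{\mathcal M}(q',p')$. If $q'>q$ and $\dfrac{q'-q}{p'-p}\ge\mu^-_{p/q}$, then $(q,p)\prec_{\mathcal M}(q',p')$.
   Context: Markov numbers indexed by rationals: for fractions in lowest terms in $[0,1]$ together with $1/0$, define $m_{0/1}=1$, $m_{1/0}=1$, $m_{1/1}=2$, and recursively, whenever $a/b<c/d$ are fractions in lowest terms in $[0,1]$ with $bc-ad=1$, set $m_{(a+c)/(b+d)}=3\,m_{a/b}\,m_{c/d}-m_{(c-a)/(d-b)}$ (with $(c-a)/(d-b)$ read as $1/0$ when $d=b$). Let $\mathcal Q$ be the set of pairs of relatively prime integers $(q,p)$ with $q\ge p\ge0$ ($q\ge1$), ordered strictly by $(q,p)\prec_{\mathcal M}(q',p')$ iff $m_{p/q}<m_{p'/q'}$. Let $T(p/q)=p/(q-p)$ (so $T(1/2)=1/1$ and $T(1/1)=1/0$). Fock's function $\Psi:[0,1/2]\to\mathbb R$ is defined at rationals by $\Psi(p/q)=\frac1q\cosh^{-1}\!\left(\frac32 m_{T(p/q)}\right)$ and extended continuously; it is known (Fock) to be continuous, convex and decreasing, so it has one-sided derivatives at interior points, a right-derivative at $0$ and a left-derivative at $1/2$. For $(q,p)\in\mathcal Q$ put $\ell=\cosh^{-1}\!\left(\frac32 m_{p/q}\right)$, let $R$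 be the right-derivative and $L$ the left-derivative of $\Psi$ at $t=p/(p+q)$, and define $\mu^+_{p/q}=-\dfrac{\ell-Rp}{\ell+Rq}$ and $\mu^-_{p/q}=-\dfrac{\ell-Lp}{\ell+Lq}$.
   Formalization: The quotient (q'-q)/(p'-p) is replaced by the slope (p'-p)/(q'-q) in both claims; as printed the claim fails, e.g. for (q,p)=(5,1), (q',p')=(3,2), where the quotient is -2 ≤ μ⁺ ≈ -1.24 and q'<q, but m_{1/5}=89 > 29=m_{2/3}. *)

theory Defs
  imports "HOL-Analysis.Analysis" "HOL-Number_Theory.Cong"
begin

section \<open>Markov numbers indexed by fractions\<close>

text \<open>
  \<open>markov_rel p q m\<close> says that \<open>m\<close> is the Markov number attached to the fraction \<open>p/q\<close>, given by
  its reduced numerator and denominator; \<open>1/0\<close> is allowed. In the rule \<open>mediant\<close> the condition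
  \<open>b * c - a * d = 1\<close> contains both \<open>a/b < c/d\<close> and the fact that \<open>a/b\<close> and \<open>c/d\<close> are in lowest
  terms. The fraction \<open>(c - a)/(d - b)\<close> is written with non-negative denominator: if \<open>d < b\<close>, both
  of its terms change sign; if \<open>d = b\<close>, then \<open>c - a = 1\<close>, so that it is literally \<open>1/0\<close>.
\<close>

inductive markov_rel :: "int \<Rightarrow> int \<Rightarrow> int \<Rightarrow> bool" where
  zero: "markov_rel 0 1 1"
| infinity: "markov_rel 1 0 1"
| one: "markov_rel 1 1 2"
| mediant:
    "\<lbrakk>0 \<le> a; a \<le> b; 0 < b; 0 \<le> c; c \<le> d; 0 < d; b * c - a * d = 1;
      markov_rel a b x; markov_rel c d y;
      markov_rel (if b \<le> d then c - a else a - c) \<bar>d - b\<bar> z\<rbrakk>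
     \<Longrightarrow> markov_rel (a + c) (b + d) (3 * x * y - z)"

definition markov :: "int \<Rightarrow> int \<Rightarrow> int" where
  "markov p q = (THE m. markov_rel p q m)"

text \<open>The description is proper: every reduced fraction in \<open>[0,1]\<close> has exactly one Markov number.\<close>

lemma markov_rel_exists:
  assumes "0 \<le> p" "p \<le> q" "1 \<le> q" "coprime p q"
  shows "\<exists>m. markov_rel p q m"
  using assms
proof (induction "nat q" arbitrary: p q rule: less_induct)
  case less
  show ?case
  proof (cases "q = 1")
    case True
    then have "p = 0 \<or> p = 1" using less.prems by auto
    then show ?thesis using True zero one by blast
  next
    case False
    then have q: "q \<ge> 2" using less.prems by simp
    have "p \<noteq> 0" using less.prems False by (auto simp: coprime_iff_gcd_eq_1)
    then have p: "p \<ge> 1" using less.prems by simp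
    have "p \<noteq> q" using less.prems q by auto
    then have pq: "p < q" using less.prems by simp
    obtain u where u: "[p * u = 1] (mod q)"
      using cong_solve_coprime_int[OF less.prems(4)] by blast
    define b where "b = u mod q"
    have bcong: "(b * p) mod q = 1"
      using u q by (simp add: b_def cong_def mult.commute mod_mult_right_eq)
    define a where "a = (b * p) div q"
    have ab: "b * p = a * q + 1"
      using div_mult_mod_eq[of "b * p" q] bcong by (simp add: a_def)
    have b0: "0 \<le> b" "b < q" using q by (auto simp: b_def)
    have "b \<noteq> 0" using bcong by auto
    then have b: "1 \<le> b" using b0 by simp
    define c where "c = p - a"
    define d where "d = q - b"
    have d: "1 \<le> d" using b0 by (simp add: d_def)
    have a0: "0 \<le> a" using b p q by (simp add: a_def pos_imp_zdiv_nonneg_iff)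
    have ap: "a < p"
    proof (rule ccontr)
      assume "\<not> a < p"
      then have "p * q \<le> a * q" using q by (intro mult_right_mono) auto
      moreover have "b * p < q * p" using b0 p by simp
      ultimately show False using ab by (simp add: mult.commute)
    qed
    have alb: "a < b"
    proof (rule ccontr)
      assume "\<not> a < b"
      then have "b * q \<le> a * q" using q by (intro mult_right_mono) auto
      moreover have "b * p < b * q" using pq b by simp
      ultimately show False using ab by simp
    qed
    have det: "b * c - a * d = 1" using ab by (simp add: c_def d_def algebra_simps)
    have "0 < (q - b) * (q - p)" using b0 pq by simp
    have cd: "c \<le> d"
    proof (rule ccontr)
      assume "\<not> c \<le> d"
      then have "d + 1 \<le> c" by simp
      then have "b * (d + 1) \<le> b * c" using b by (intro mult_left_mono) auto
      then have "(b - a) * d + b \<le> 1" using det by (simp add: algebra_simps)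
      moreover have "0 < (b - a) * d" using alb d by simp
      ultimately show False using b by simp
    qed
    have cop: "coprime a b" "coprime c d"
    proof -
      show "coprime a b"
      proof (rule coprimeI)
        fix k assume "k dvd a" "k dvd b"
        then have "k dvd b * c - a * d" by simp
        then show "is_unit k" using det by simp
      qed
      show "coprime c d"
      proof (rule coprimeI)
        fix k assume "k dvd c" "k dvd d"
        then have "k dvd b * c - a * d" by simp
        then show "is_unit k" using det by simp
      qed
    qed
    obtain x where x: "markov_rel a b x"
      using less.hyps[of b a] b b0 a0 alb cop by auto
    obtain y where y: "markov_rel c d y"
      using less.hyps[of d c] d b ap cd cop by (auto simp: c_def d_def)
    define e where "e = (if b \<le> d then c - a else a - c)"
    define f where "f = \<bar>d - b\<bar>"
    have "\<exists>z. markov_rel e f z"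
    proof (cases "b = d")
      case True
      then have "b * (c - a) = 1" using det by (simp add: algebra_simps)
      then have "c - a = 1" using b by (simp add: zmult_eq_1_iff)
      then show ?thesis using True infinity by (auto simp: e_def f_def)
    next
      case bd: False
      have f: "1 \<le> f" "f < q" using bd b d by (auto simp: f_def d_def)
      have cop': "coprime e f"
      proof (rule coprimeI)
        fix k assume k: "k dvd e" "k dvd f"
        then have "k dvd c - a" "k dvd d - b"
          by (auto simp: e_def f_def dvd_diff_commute split: if_splits)
        then have "k dvd b * (c - a) - a * (d - b)" by simp
        then show "is_unit k" using det by (simp add: algebra_simps)
      qed
      have ef: "0 \<le> e \<and> e \<le> f"
      proof (cases "b \<le> d")
        case True
        have f': "f = d - b" "e = c - a" using True by (auto simp: e_def f_def)
        have 1: "b * e = a * f + 1" using det by (simp add: f' algebra_simps)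
        have "0 \<le> a * f" using a0 f by simp
        then have "0 < b * e" using 1 by simp
        then have "0 < e" using b by (simp add: zero_less_mult_iff)
        moreover have "e \<le> f"
        proof (rule ccontr)
          assume "\<not> e \<le> f"
          then have "b * (f + 1) \<le> b * e" using b by (intro mult_left_mono) auto
          then have "(b - a) * f + b \<le> 1" using 1 by (simp add: algebra_simps)
          moreover have "0 < (b - a) * f" using alb f by simp
          ultimately show False using b by simp
        qed
        ultimately show ?thesis by simp
      next
        case False
        have f': "f = b - d" "e = a - c" using False by (auto simp: e_def f_def)
        have 1: "d * e = c * f - 1" using det by (simp add: f' algebra_simps)
        have "0 < c" using ap by (simp add: c_def)
        then have "0 < c * f" using f by simp
        then have "0 \<le> d * e" using 1 by simp
        then have "0 \<le> e" using d by (simp add: zero_le_mult_iff)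
        moreover have "e \<le> f"
        proof -
          have "c * f \<le> d * f" using cd f by (intro mult_right_mono) auto
          then have "d * e < d * f" using 1 by linarith
          then show ?thesis using d by simp
        qed
        ultimately show ?thesis by simp
      qed
      show ?thesis using less.hyps[of f e] f ef cop' by auto
    qed
    then obtain z where z: "markov_rel e f z" by blast
    have "markov_rel (a + c) (b + d) (3 * x * y - z)"
      using a0 alb b ap cd d det x y z
      by (intro mediant) (auto simp: c_def e_def f_def)
    then show ?thesis by (auto simp: c_def d_def)
  qed
qed

lemma markov_rel_unique:
  assumes "markov_rel p q m" "markov_rel p q m'"
  shows "m = m'"
  using assms
proof (induction arbitrary: m' rule: markov_rel.induct)
  case zero
  then show ?case by (cases rule: markov_rel.cases) auto
next
  case infinity
  then show ?case by (cases rule: markov_rel.cases) auto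
next
  case one
  then show ?case by (cases rule: markov_rel.cases) auto
next
  case (mediant a b c d x y z)
  from mediant.prems show ?case
  proof (cases rule: markov_rel.cases)
    case (mediant a' b' c' d' x' y' z')
    note m2 = mediant
    have e1: "b * (a + c) = a * (b + d) + 1"
      using \<open>b * c - a * d = 1\<close> by (simp add: algebra_simps)
    have "b' * (a' + c') = a' * (b' + d') + 1"
      using m2 by (simp add: algebra_simps)
    then have e2: "b' * (a + c) = a' * (b + d) + 1" using m2 by simp
    have "coprime (b + d) (a + c)"
    proof (rule coprimeI)
      fix k assume "k dvd b + d" "k dvd a + c"
      then have "k dvd b * (a + c) - a * (b + d)" by simp
      then show "is_unit k" using e1 by simp
    qed
    moreover have "(b - b') * (a + c) = (a - a') * (b + d)"
      using e1 e2 by (simp add: algebra_simps)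
    then have "(b + d) dvd (b - b') * (a + c)" by simp
    ultimately have dv: "(b + d) dvd (b - b')"
      using coprime_dvd_mult_left_iff by blast
    have "\<bar>b - b'\<bar> < b + d" using m2 mediant.hyps by linarith
    then have bb: "b = b'" using dvd_imp_le_int[OF _ dv] mediant.hyps by fastforce
    then have "a * (b + d) = a' * (b + d)" using e1 e2 by (metis add_right_cancel)
    moreover have "b + d \<noteq> 0" using mediant.hyps by linarith
    ultimately have aa: "a = a'" by (simp only: mult_cancel_right) simp
    have "c = c'" "d = d'" using aa bb m2 by auto
    then show ?thesis using aa bb m2 mediant.IH by auto
  qed (use mediant.hyps in auto)
qed

lemma markov_rel_markov:
  assumes "0 \<le> p" "p \<le> q" "1 \<le> q" "coprime p q"
  shows "markov_rel p q (markov p q)"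
  unfolding markov_def
  using markov_rel_exists[OF assms] markov_rel_unique by (metis theI)

text \<open>Elements of \<open>markov_pairs\<close> are pairs \<open>(q, p)\<close>: the denominator comes first.\<close>

definition markov_pairs :: "(int \<times> int) set" where
  "markov_pairs = {(q, p). coprime q p \<and> q \<ge> p \<and> p \<ge> 0 \<and> q \<ge> 1}"

definition markov_less :: "int \<times> int \<Rightarrow> int \<times> int \<Rightarrow> bool"  (infix "\<prec>\<^sub>M" 50) where
  "x \<prec>\<^sub>M y \<longleftrightarrow> (case x of (q, p) \<Rightarrow> case y of (q', p') \<Rightarrow> markov p q < markov p' q')"


section \<open>Fock's function and the slopes\<close>

text \<open>
  On a rational \<open>p/q\<close> in lowest terms the value involves the Markov number of
  \<open>T(p/q) = p/(q - p)\<close>, again in lowest terms.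
\<close>

definition fock_rat :: "rat \<Rightarrow> real" where
  "fock_rat r = (case quotient_of r of (p, q) \<Rightarrow>
     arcosh (3 / 2 * real_of_int (markov p (q - p))) / real_of_int q)"

text \<open>
  The extension by continuity to \<open>[0,1/2]\<close>: a rational keeps its value, an irrational gets the limit
  along the rationals of \<open>[0,1/2]\<close>. Values outside \<open>[0,1/2]\<close> carry no meaning.
\<close>

definition fock :: "real \<Rightarrow> real" where
  "fock t = (if t \<in> \<rat> then fock_rat (inv real_of_rat t)
     else Lim (at t within \<rat> \<inter> {0..1/2}) (\<lambda>s. fock_rat (inv real_of_rat s)))"

definition right_deriv :: "(real \<Rightarrow> real) \<Rightarrow> real \<Rightarrow> real" where
  "right_deriv f t = (SOME D. (f has_real_derivative D) (at_right t))"

definition left_deriv :: "(real \<Rightarrow> real) \<Rightarrow> real \<Rightarrow> real" where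
  "left_deriv f t = (SOME D. (f has_real_derivative D) (at_left t))"

text \<open>
  Here \<open>p\<close> and \<open>q\<close> are the terms of a reduced fraction in \<open>[0,1]\<close> and \<open>t = p/(p + q)\<close>. Fock's
  function lives on \<open>[0,1/2]\<close> and has no right derivative at \<open>t = 1/2\<close> (\<open>p/q = 1/1\<close>) and no left
  derivative at \<open>t = 0\<close> (\<open>p/q = 0/1\<close>), so \<open>mu_plus 1 1\<close> and \<open>mu_minus 0 1\<close> carry no meaning.
  Both numbers are slopes \<open>dp/dq\<close>, \<open>q\<close> being the abscissa and \<open>p\<close> the ordinate: the tangent
  slopes at \<open>(q, p)\<close> of the level curve of \<open>(q, p) \<mapsto> (p + q) * fock (p/(p + q))\<close>. They are to be
  compared with \<open>(p' - p)/(q' - q)\<close>.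
\<close>

definition mu_plus :: "int \<Rightarrow> int \<Rightarrow> real" where
  "mu_plus p q =
     (let l = arcosh (3 / 2 * real_of_int (markov p q));
          R = right_deriv fock (real_of_int p / real_of_int (p + q))
      in - ((l - R * real_of_int p) / (l + R * real_of_int q)))"

definition mu_minus :: "int \<Rightarrow> int \<Rightarrow> real" where
  "mu_minus p q =
     (let l = arcosh (3 / 2 * real_of_int (markov p q));
          L = left_deriv fock (real_of_int p / real_of_int (p + q))
      in - ((l - L * real_of_int p) / (l + L * real_of_int q)))"

end

(*
  Put F(q, p) = arcosh (3/2 m) with m the Markov number of p/q. The recursion reads
  cosh F(u + v) + cosh F(u - v) = 2 cosh F(u) cosh F(v) for Farey neighbours u, v, and together with
  the Markov equation it yields, for every primitive w, a linear form that agrees with F at w and lies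
  strictly below F at all Farey neighbours of w. Hence F is strictly convex along every Farey chain,
  and the linear form lies below F at every other primitive vector. Since Fock's function satisfies
  (p + q) fock(p/(p + q)) = F(q, p), it has strict support lines at the rationals, so it is convex on
  the interior, and its one-sided derivatives are strict subgradients. The numbers mu_plus and
  mu_minus are the slopes of the level lines of the corresponding linear forms, and the slope
  condition says that (q', p') lies on or above that line, where F is larger.
*)
theory Submission
  imports Defs
begin

section \<open>Farey chains and their Markov numbers\<close>

text \<open>
  The \<open>n\<close>-th subdivision of \<open>[0/1, 1/1]\<close> by mediants, with entries \<open>0, \<dots>, 2 ^ n\<close>; larger indices
  carry no meaning.
\<close>

fun farey_num :: "nat \<Rightarrow> nat \<Rightarrow> int" where
  "farey_num 0 i = int i"
| "farey_num (Suc n) i = (if even i then farey_num n (i div 2)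
     else farey_num n (i div 2) + farey_num n (Suc (i div 2)))"

fun farey_den :: "nat \<Rightarrow> nat \<Rightarrow> int" where
  "farey_den 0 i = 1"
| "farey_den (Suc n) i = (if even i then farey_den n (i div 2)
     else farey_den n (i div 2) + farey_den n (Suc (i div 2)))"

definition farey_markov :: "nat \<Rightarrow> nat \<Rightarrow> int" where
  "farey_markov n i = markov (farey_num n i) (farey_den n i)"

text \<open>The Markov number of the difference of the entries \<open>i\<close> and \<open>i + 1\<close>, as vectors.\<close>

fun farey_diff :: "nat \<Rightarrow> nat \<Rightarrow> int" where
  "farey_diff 0 i = 1"
| "farey_diff (Suc n) i = farey_markov n (if even i then Suc (i div 2) else i div 2)"

lemma markov_eqI: "markov_rel p q m \<Longrightarrow> markov p q = m"
  unfolding markov_def using markov_rel_unique by blast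

lemma farey_bounds: "i \<le> 2 ^ n \<Longrightarrow> 0 \<le> farey_num n i \<and> farey_num n i \<le> farey_den n i \<and> 1 \<le> farey_den n i"
proof (induction n arbitrary: i)
  case 0
  then show ?case by auto
next
  case (Suc n)
  have "i div 2 \<le> 2 ^ n" using Suc.prems by auto
  moreover have "Suc (i div 2) \<le> 2 ^ n" if "odd i"
    using Suc.prems that by (auto elim!: oddE)
  ultimately show ?case using Suc.IH[of "i div 2"] Suc.IH[of "Suc (i div 2)"] by auto
qed

lemma farey_det:
  "i < 2 ^ n \<Longrightarrow> farey_den n i * farey_num n (Suc i) - farey_num n i * farey_den n (Suc i) = 1"
proof (induction n arbitrary: i)
  case 0
  then show ?case by auto
next
  case (Suc n)
  have "i div 2 < 2 ^ n" using Suc.prems by auto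
  note IH = Suc.IH[OF this]
  show ?case
  proof (cases "even i")
    case True
    then show ?thesis using IH by (auto simp: algebra_simps)
  next
    case False
    then show ?thesis using IH by (auto simp: algebra_simps)
  qed
qed

lemma coprime_if_det:
  fixes a b c d :: int
  assumes det: "b * c - a * d = 1"
  shows "coprime a b" "coprime c d"
proof -
  show "coprime a b"
  proof (rule coprimeI)
    fix k assume "k dvd a" "k dvd b"
    then have "k dvd b * c - a * d" by simp
    then show "is_unit k" using det by simp
  qed
  show "coprime c d"
  proof (rule coprimeI)
    fix k assume "k dvd c" "k dvd d"
    then have "k dvd b * c - a * d" by simp
    then show "is_unit k" using det by simp
  qed
qed

lemma farey_coprime:
  assumes "i \<le> 2 ^ n"
  shows "coprime (farey_num n i) (farey_den n i)"
proof (cases "i < 2 ^ n")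
  case True
  then show ?thesis using coprime_if_det(1)[OF farey_det] by blast
next
  case False
  then have "i = Suc (2 ^ n - 1)" using assms by auto
  then show ?thesis using coprime_if_det(2)[OF farey_det[of "2 ^ n - 1" n]] by simp
qed

lemma farey_markov_rel: "i \<le> 2 ^ n \<Longrightarrow> markov_rel (farey_num n i) (farey_den n i) (farey_markov n i)"
  unfolding farey_markov_def using farey_bounds farey_coprime by (intro markov_rel_markov) auto

section \<open>Recursion and Markov equation along the Farey chains\<close>

lemma farey_markov_even [simp]: "farey_markov (Suc n) (2 * i) = farey_markov n i"
  by (simp add: farey_markov_def)

text \<open>A mediant differs from either parent by the other parent, so \<open>farey_diff\<close>
  supplies the third Markov number in the rule \<open>mediant\<close>; the initial pair has
  difference 1/0.\<close>

lemma farey_diff_rel: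
  "i < 2 ^ n \<Longrightarrow> markov_rel
     (if farey_den n i \<le> farey_den n (Suc i) then farey_num n (Suc i) - farey_num n i
      else farey_num n i - farey_num n (Suc i))
     \<bar>farey_den n (Suc i) - farey_den n i\<bar> (farey_diff n i)"
proof (induction n arbitrary: i)
  case 0
  then show ?case by (auto intro: markov_rel.intros)
next
  case (Suc n)
  have i: "i div 2 < 2 ^ n" using Suc.prems by auto
  have b: "1 \<le> farey_den n (i div 2)" "1 \<le> farey_den n (Suc (i div 2))"
    using farey_bounds[of _ n] i by auto
  have "markov_rel (farey_num n (i div 2)) (farey_den n (i div 2)) (farey_markov n (i div 2))"
    "markov_rel (farey_num n (Suc (i div 2))) (farey_den n (Suc (i div 2))) (farey_markov n (Suc (i div 2)))"
    using farey_markov_rel[of _ n] i by auto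
  then show ?case using b by auto
qed

lemma farey_markov_mediant:
  assumes "i < 2 ^ n"
  shows "farey_markov (Suc n) (Suc (2 * i)) = 3 * farey_markov n i * farey_markov n (Suc i) - farey_diff n i"
proof -
  have "markov_rel (farey_num n i + farey_num n (Suc i)) (farey_den n i + farey_den n (Suc i))
    (3 * farey_markov n i * farey_markov n (Suc i) - farey_diff n i)"
    using assms farey_bounds[of i n] farey_bounds[of "Suc i" n]
    by (intro markov_rel.mediant farey_det farey_markov_rel farey_diff_rel) auto
  then show ?thesis by (simp add: farey_markov_def[of "Suc n"] markov_eqI)
qed

lemma farey_markov_0: "farey_markov 0 0 = 1" "farey_markov 0 (Suc 0) = 2"
  by (auto simp: farey_markov_def intro!: markov_eqI markov_rel.intros)

text \<open>Vieta jumping: refinement keeps two members \<open>x\<close>, \<open>y\<close> of the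
  triple and brings in \<open>3 * x * y - z\<close>, the other root of the equation read as a
  quadratic in \<open>z\<close>.\<close>

lemma farey_markov_equation:
  "i < 2 ^ n \<Longrightarrow> 1 \<le> farey_markov n i \<and> 1 \<le> farey_markov n (Suc i) \<and> 1 \<le> farey_diff n i \<and>
    farey_markov n i ^ 2 + farey_markov n (Suc i) ^ 2 + farey_diff n i ^ 2
      = 3 * farey_markov n i * farey_markov n (Suc i) * farey_diff n i"
proof (induction n arbitrary: i)
  case 0
  then show ?case by (auto simp: farey_markov_0)
next
  case (Suc n)
  define j where "j = i div 2"
  have j: "j < 2 ^ n" using Suc.prems by (auto simp: j_def)
  define x y z where "x = farey_markov n j" and "y = farey_markov n (Suc j)" and "z = farey_diff n j"
  note IH = Suc.IH[OF j, folded x_def y_def z_def]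
  have med: "farey_markov (Suc n) (Suc (2 * j)) = 3 * x * y - z"
    using farey_markov_mediant[OF j] by (simp add: x_def y_def z_def)
  \<comment> \<open>The product of the two roots is positive, hence so is the new root.\<close>
  have "(3 * x * y - z) * z = x ^ 2 + y ^ 2" using IH by algebra
  moreover have "x ^ 2 + y ^ 2 > 0" using IH by (simp add: sum_power2_gt_zero_iff)
  ultimately have "(3 * x * y - z) * z > 0" by simp
  then have pos: "3 * x * y - z > 0" using IH by (simp add: zero_less_mult_iff)
  have vieta: "x\<^sup>2 + (3 * x * y - z)\<^sup>2 + y\<^sup>2 = 3 * x * (3 * x * y - z) * y"
    "(3 * x * y - z)\<^sup>2 + y\<^sup>2 + x\<^sup>2 = 3 * (3 * x * y - z) * y * x"
    using IH by algebra+
  show ?case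
  proof (cases "even i")
    case True
    then have i: "i = 2 * j" by (simp add: j_def)
    have "farey_markov (Suc n) i = x" by (simp add: i x_def)
    moreover have "farey_diff (Suc n) i = y" by (simp add: i y_def)
    ultimately show ?thesis using med IH pos vieta by (simp only: i) auto
  next
    case False
    then have i: "i = Suc (2 * j)" by (simp add: j_def)
    have "farey_markov (Suc n) (Suc i) = y" using farey_markov_even[of n "Suc j"] by (simp add: i y_def)
    moreover have "farey_diff (Suc n) i = x" by (simp add: i x_def)
    ultimately show ?thesis using med IH pos vieta by (simp only: i) auto
  qed
qed

text \<open>Euclidean descent: subtracting the vector with the smaller denominator from the other
  undoes one mediant. Equal denominators force the initial pair 0/1, 1/1.\<close>

lemma farey_consecutive:
  assumes "0 \<le> a" "a \<le> b" "0 < b" "0 \<le> c" "c \<le> d" "0 < d" "b * c - a * d = 1"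
  shows "\<exists>n i. i < 2 ^ n \<and> farey_num n i = a \<and> farey_den n i = b
    \<and> farey_num n (Suc i) = c \<and> farey_den n (Suc i) = d"
  using assms
proof (induction "nat (b + d)" arbitrary: a b c d rule: less_induct)
  case less
  consider "b = d" | "b < d" | "d < b" by linarith
  then show ?case
  proof cases
    case 1
    then have "b * (c - a) = 1" using less.prems by (simp add: algebra_simps)
    then have "b = 1" "c - a = 1" using less.prems by (auto simp: zmult_eq_1_iff)
    then have "a = 0" "c = 1" "d = 1" using 1 less.prems by auto
    then show ?thesis using \<open>b = 1\<close> by (intro exI[of _ 0]) auto
  next
    case 2
    have e: "b * (c - a) - a * (d - b) = 1" using less.prems by (simp add: algebra_simps)
    have "0 \<le> a * (d - b)" using less.prems 2 by simp
    then have "0 < b * (c - a)" using e by simp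
    then have "0 \<le> c - a" using less.prems by (simp add: zero_less_mult_iff)
    moreover have "c - a \<le> d - b"
    proof (rule ccontr)
      assume "\<not> ?thesis"
      then have "b * (d - b + 1) \<le> b * (c - a)" using less.prems by (intro mult_left_mono) auto
      then have "(b - a) * (d - b) + b \<le> 1" using e by (simp add: algebra_simps)
      moreover have "0 \<le> (b - a) * (d - b)" using less.prems 2 by simp
      moreover have "a < b"
      proof (rule ccontr)
        assume "\<not> a < b"
        then have "a = b" using less.prems by simp
        then have "b * (c - d) = 1" using less.prems by (simp add: algebra_simps)
        then show False using less.prems by (auto simp: zmult_eq_1_iff)
      qed
      then have "0 < (b - a) * (d - b)" using 2 by simp
      ultimately show False using less.prems by linarith
    qed
    ultimately obtain n i where "i < 2 ^ n" "farey_num n i = a" "farey_den n i = b"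
      "farey_num n (Suc i) = c - a" "farey_den n (Suc i) = d - b"
      using less.hyps[of b "d - b" a "c - a"] less.prems 2 e by auto
    then show ?thesis by (intro exI[of _ "Suc n"] exI[of _ "2 * i"]) auto
  next
    case 3
    have e: "(b - d) * c - (a - c) * d = 1" using less.prems by (simp add: algebra_simps)
    have "c > 0"
    proof (rule ccontr)
      assume "\<not> c > 0"
      then have "c = 0" using less.prems by simp
      then show False using less.prems mult_nonneg_nonneg[of a d] by simp
    qed
    then have "0 < c * (b - d)" using 3 by simp
    then have "0 \<le> d * (a - c)" using e by (simp add: algebra_simps)
    then have "0 \<le> a - c" using less.prems by (simp add: zero_le_mult_iff)
    moreover have "a - c \<le> b - d"
    proof -
      have "c * (b - d) \<le> d * (b - d)" using less.prems 3 by (intro mult_right_mono) auto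
      then have "d * (a - c) < d * (b - d)" using e by (simp add: algebra_simps)
      then show ?thesis using less.prems by simp
    qed
    ultimately obtain n i where "i < 2 ^ n" "farey_num n i = a - c" "farey_den n i = b - d"
      "farey_num n (Suc i) = c" "farey_den n (Suc i) = d"
      using less.hyps[of "b - d" d "a - c" c] less.prems 3 e by auto
    then show ?thesis by (intro exI[of _ "Suc n"] exI[of _ "Suc (2 * i)"]) auto
  qed
qed

text \<open>The last rule in the derivation of the Markov number exhibits \<open>p/q\<close> as an
  end of the initial interval or as a mediant of Farey neighbours.\<close>

lemma farey_exists:
  assumes "0 \<le> p" "p \<le> q" "1 \<le> q" "coprime p q"
  shows "\<exists>n i. i \<le> 2 ^ n \<and> farey_num n i = p \<and> farey_den n i = q"
  using markov_rel_markov[OF assms]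
proof (cases rule: markov_rel.cases)
  case zero
  then show ?thesis by (intro exI[of _ 0]) auto
next
  case infinity
  then show ?thesis using assms by auto
next
  case one
  then show ?thesis by (intro exI[of _ 0] exI[of _ "Suc 0"]) auto
next
  case (mediant a b c d x y z)
  then obtain n i where "i < 2 ^ n" "farey_num n i = a" "farey_den n i = b"
      "farey_num n (Suc i) = c" "farey_den n (Suc i) = d"
    using farey_consecutive[of a b c d] by auto
  then show ?thesis using mediant by (intro exI[of _ "Suc n"] exI[of _ "Suc (2 * i)"]) auto
qed

text \<open>Brings entries of different levels into one common chain.\<close>

lemma farey_refine: "farey_num (n + m) (2 ^ m * i) = farey_num n i" "farey_den (n + m) (2 ^ m * i) = farey_den n i"
proof (induction m)
  case (Suc m)
  { case 1 then show ?case using Suc by (simp add: mult.assoc) }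
  { case 2 then show ?case using Suc by (simp add: mult.assoc) }
qed simp_all

section \<open>Support functionals of the length function\<close>

text \<open>Put \<open>w = cosh l\<close>. Scaling \<open>x\<close> and \<open>z\<close> by
  \<open>sinh l / w\<close> to \<open>u\<close> and \<open>v\<close> turns the equation into
  \<open>(v - u * w)^2 = (sinh l)^2 * (u^2 - 1)\<close>, so that \<open>u = cosh s\<close> makes
  \<open>v\<close> equal to \<open>cosh (s + l)\<close> or \<open>cosh (s - l)\<close>.\<close>

lemma markov_equation_cosh:
  fixes x z w :: real
  assumes "1 < w" "0 < x" and eq: "x\<^sup>2 + z\<^sup>2 + w\<^sup>2 = 2 * x * z * w"
  obtains s where "x * sinh (arcosh w) = w * cosh s" "z * sinh (arcosh w) = w * cosh (s - arcosh w)"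
proof -
  define S where "S = sinh (arcosh w)"
  have S: "S > 0" "S\<^sup>2 = w\<^sup>2 - 1"
    using assms by (simp_all add: S_def sinh_square_eq)
  define u v where "u = x * S / w" and "v = z * S / w"
  have uv: "u * w = x * S" "v * w = z * S" using assms by (simp_all add: u_def v_def)
  have "w\<^sup>2 * (v - u * w)\<^sup>2 = w\<^sup>2 * (S\<^sup>2 * (u\<^sup>2 - 1))"
    using eq S(2) uv by algebra
  then have sq: "(v - u * w)\<^sup>2 = S\<^sup>2 * (u\<^sup>2 - 1)" using assms by simp
  then have "0 \<le> S\<^sup>2 * (u\<^sup>2 - 1)" by (metis zero_le_power2)
  then have "u\<^sup>2 \<ge> 1" using S(1) by (metis diff_ge_0_iff_ge mult_less_0_iff not_less zero_less_power)
  moreover have "u > 0" using assms S by (simp add: u_def)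
  ultimately have u: "u \<ge> 1" by (intro power2_le_imp_le[of 1 u]) auto
  define s where "s = arcosh u"
  have s: "cosh s = u" "(sinh s)\<^sup>2 = u\<^sup>2 - 1" using u by (simp_all add: s_def sinh_square_eq)
  have "(v - u * w)\<^sup>2 = (S * sinh s)\<^sup>2" using sq s by (simp add: power_mult_distrib)
  then have "v - u * w = S * sinh s \<or> v - u * w = - (S * sinh s)" by (simp add: power2_eq_iff)
  then have "v = cosh (- s - arcosh w) \<or> v = cosh (s - arcosh w)"
    using assms s by (auto simp: cosh_diff S_def algebra_simps)
  \<comment> \<open>Evenness of \<open>cosh\<close> absorbs the sign: \<open>r\<close> is
    \<open>s\<close> or \<open>- s\<close>.\<close>
  then obtain r where "cosh r = u" "cosh (r - arcosh w) = v" using s by (metis cosh_minus)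
  then show ?thesis using that[of r] uv by (simp add: S_def mult.commute)
qed

definition cosh_len :: "nat \<Rightarrow> nat \<Rightarrow> real" where
  "cosh_len n i = 3 / 2 * real_of_int (farey_markov n i)"

definition len :: "nat \<Rightarrow> nat \<Rightarrow> real" where
  "len n i = arcosh (cosh_len n i)"

definition cosh_diff_len :: "nat \<Rightarrow> nat \<Rightarrow> real" where
  "cosh_diff_len n i = 3 / 2 * real_of_int (farey_diff n i)"

definition lin :: "real \<Rightarrow> real \<Rightarrow> nat \<Rightarrow> nat \<Rightarrow> real" where
  "lin \<alpha> \<beta> n i = \<alpha> * real_of_int (farey_den n i) + \<beta> * real_of_int (farey_num n i)"

text \<open>
  Let \<open>w\<close> be the entry \<open>i\<close> and \<open>l\<close> its length. The Markov numbers along the lattice line \<open>v + k w\<close>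
  satisfy \<open>X (k + 1) + X (k - 1) = 2 cosh l X k\<close>, so that \<open>X k = coth l * cosh (s + k l)\<close> for some
  \<open>s\<close>; the factor \<open>coth l > 1\<close> comes from the Markov equation. The linear form taking the value \<open>l\<close>
  at \<open>w\<close> and \<open>s\<close> at \<open>v\<close> therefore stays below the length. The predicate records this for a
  neighbour \<open>j\<close> of \<open>i\<close>, with \<open>k\<close> the index of their difference; it is multiplied out by \<open>sinh l\<close>.
\<close>

definition tangent :: "nat \<Rightarrow> nat \<Rightarrow> nat \<Rightarrow> nat \<Rightarrow> real \<Rightarrow> real \<Rightarrow> bool" where
  "tangent n i j k \<alpha> \<beta> \<longleftrightarrow> lin \<alpha> \<beta> n i = len n i
    \<and> cosh_len n j * sinh (len n i) = cosh_len n i * cosh (lin \<alpha> \<beta> n j)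
    \<and> cosh_diff_len n k * sinh (len n i) = cosh_len n i * cosh (lin \<alpha> \<beta> n j - len n i)"

lemma cosh_len_gt_1: "i \<le> 2 ^ n \<Longrightarrow> 1 < cosh_len n i"
proof -
  assume "i \<le> 2 ^ n"
  then consider "i < 2 ^ n" | "i = Suc (2 ^ n - 1)" "2 ^ n - 1 < (2::nat) ^ n" by fastforce
  then have "1 \<le> farey_markov n i"
    by cases (use farey_markov_equation[of i n] farey_markov_equation[of "2 ^ n - 1" n] in auto)
  then show ?thesis unfolding cosh_len_def by simp
qed

lemma cosh_len [simp]: "i \<le> 2 ^ n \<Longrightarrow> cosh (len n i) = cosh_len n i"
  using cosh_len_gt_1[of i n] by (simp add: len_def)

lemma len_pos: "i \<le> 2 ^ n \<Longrightarrow> 0 < len n i"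
  using cosh_len_gt_1[of i n] by (simp add: len_def)

lemma refine_simps:
  "cosh_len (Suc n) (2 * i) = cosh_len n i"
  "cosh_len (Suc n) (Suc (Suc (2 * i))) = cosh_len n (Suc i)"
  "len (Suc n) (2 * i) = len n i"
  "len (Suc n) (Suc (Suc (2 * i))) = len n (Suc i)"
  "lin \<alpha> \<beta> (Suc n) (2 * i) = lin \<alpha> \<beta> n i"
  "lin \<alpha> \<beta> (Suc n) (Suc (Suc (2 * i))) = lin \<alpha> \<beta> n (Suc i)"
  "lin \<alpha> \<beta> (Suc n) (Suc (2 * i)) = lin \<alpha> \<beta> n i + lin \<alpha> \<beta> n (Suc i)"
  "cosh_diff_len (Suc n) (2 * i) = cosh_len n (Suc i)"
  "cosh_diff_len (Suc n) (Suc (2 * i)) = cosh_len n i"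
  by (simp_all add: cosh_len_def len_def lin_def cosh_diff_len_def farey_markov_def algebra_simps)

lemma cosh_len_mediant:
  "i < 2 ^ n \<Longrightarrow> cosh_len (Suc n) (Suc (2 * i)) = 2 * cosh_len n i * cosh_len n (Suc i) - cosh_diff_len n i"
  unfolding cosh_len_def cosh_diff_len_def farey_markov_mediant by simp

lemma cosh_len_equation:
  assumes "i < 2 ^ n"
  shows "(cosh_len n i)\<^sup>2 + (cosh_len n (Suc i))\<^sup>2 + (cosh_diff_len n i)\<^sup>2
    = 2 * cosh_len n i * cosh_len n (Suc i) * cosh_diff_len n i"
proof -
  define x y z where "x = real_of_int (farey_markov n i)" and "y = real_of_int (farey_markov n (Suc i))"
    and "z = real_of_int (farey_diff n i)"
  have "real_of_int ((farey_markov n i)\<^sup>2 + (farey_markov n (Suc i))\<^sup>2 + (farey_diff n i)\<^sup>2)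
      = real_of_int (3 * farey_markov n i * farey_markov n (Suc i) * farey_diff n i)"
    using farey_markov_equation[OF assms] by metis
  then have "x\<^sup>2 + y\<^sup>2 + z\<^sup>2 = 3 * x * y * z" by (simp add: x_def y_def z_def)
  then have "(3 / 2 * x)\<^sup>2 + (3 / 2 * y)\<^sup>2 + (3 / 2 * z)\<^sup>2 = 2 * (3 / 2 * x) * (3 / 2 * y) * (3 / 2 * z)"
    by (simp add: power2_eq_square)
  then show ?thesis by (simp add: cosh_len_def cosh_diff_len_def x_def y_def z_def)
qed

text \<open>The identity \<open>cosh (y + l) + cosh (y - l) = 2 * cosh l * cosh y\<close> moves the
  tangent relation one step along the lattice line.\<close>

lemma tangent_step:
  fixes l x y z :: real
  assumes "x * sinh l = cosh l * cosh y" "z * sinh l = cosh l * cosh (y - l)"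
  shows "(2 * cosh l * x - z) * sinh l = cosh l * cosh (y + l)"
proof -
  have "(2 * cosh l * x - z) * sinh l = 2 * cosh l * (x * sinh l) - z * sinh l"
    by (simp add: algebra_simps)
  then show ?thesis unfolding assms by (simp add: cosh_add cosh_diff algebra_simps)
qed

text \<open>Refinement is such a step: the mediant takes the place of the neighbour, and the old
  neighbour becomes the difference.\<close>

lemma tangent_refine_right:
  assumes "i < 2 ^ n" "tangent n i (Suc i) i \<alpha> \<beta>"
  shows "tangent (Suc n) (2 * i) (Suc (2 * i)) (2 * i) \<alpha> \<beta>"
proof -
  have "(2 * cosh_len n i * cosh_len n (Suc i) - cosh_diff_len n i) * sinh (len n i)
      = cosh_len n i * cosh (lin \<alpha> \<beta> n i + lin \<alpha> \<beta> n (Suc i))"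
    using assms tangent_step[of "cosh_len n (Suc i)" "len n i" "lin \<alpha> \<beta> n (Suc i)" "cosh_diff_len n i"]
    by (simp add: tangent_def add.commute)
  then show ?thesis using assms by (auto simp: tangent_def refine_simps cosh_len_mediant)
qed

lemma tangent_refine_left:
  assumes "i < 2 ^ n" "tangent n (Suc i) i i \<alpha> \<beta>"
  shows "tangent (Suc n) (Suc (Suc (2 * i))) (Suc (2 * i)) (Suc (2 * i)) \<alpha> \<beta>"
proof -
  have "(2 * cosh_len n i * cosh_len n (Suc i) - cosh_diff_len n i) * sinh (len n (Suc i))
      = cosh_len n (Suc i) * cosh (lin \<alpha> \<beta> n i + lin \<alpha> \<beta> n (Suc i))"
    using assms tangent_step[of "cosh_len n i" "len n (Suc i)" "lin \<alpha> \<beta> n i" "cosh_diff_len n i"]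
    by (simp add: tangent_def mult.commute[of "cosh_len n i"] mult.assoc)
  then show ?thesis using assms by (auto simp: tangent_def refine_simps cosh_len_mediant)
qed

text \<open>The parents add up to the mediant, so a form with values \<open>l - s\<close> and
  \<open>s\<close> at them has value \<open>l\<close> there. The Markov equation provides the right
  \<open>s\<close>, and evenness of \<open>cosh\<close> lets one form serve both sides.\<close>

lemma tangent_mediant_exists:
  assumes i: "i < 2 ^ n"
  shows "\<exists>\<alpha> \<beta>. tangent (Suc n) (Suc (2 * i)) (Suc (Suc (2 * i))) (Suc (2 * i)) \<alpha> \<beta>
    \<and> tangent (Suc n) (Suc (2 * i)) (2 * i) (2 * i) \<alpha> \<beta>"
proof -
  define w where "w = cosh_len (Suc n) (Suc (2 * i))"
  define l where "l = arcosh w"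
  have l: "len (Suc n) (Suc (2 * i)) = l" by (simp add: l_def w_def len_def)
  have w: "1 < w" unfolding w_def using i by (intro cosh_len_gt_1) simp
  have x: "0 < cosh_len n (Suc i)" using cosh_len_gt_1[of "Suc i" n] i by simp
  have "(cosh_len n (Suc i))\<^sup>2 + (cosh_len n i)\<^sup>2 + w\<^sup>2 = 2 * cosh_len n (Suc i) * cosh_len n i * w"
    using cosh_len_equation[of "2 * i" "Suc n"] i unfolding refine_simps w_def[symmetric]
    by (simp add: ac_simps)
  then obtain s where s: "cosh_len n (Suc i) * sinh l = w * cosh s" "cosh_len n i * sinh l = w * cosh (s - l)"
    using markov_equation_cosh[OF w x] by (metis l_def)
  define q p q' p' where "q = real_of_int (farey_den n i)" and "p = real_of_int (farey_num n i)"
    and "q' = real_of_int (farey_den n (Suc i))" and "p' = real_of_int (farey_num n (Suc i))"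
  have "real_of_int (farey_den n i * farey_num n (Suc i) - farey_num n i * farey_den n (Suc i)) = 1"
    by (simp only: farey_det[OF i])
  then have det: "q * p' - p * q' = 1" by (simp add: q_def p_def q'_def p'_def)
  \<comment> \<open>Cramer's rule for prescribed values at two vectors of determinant 1.\<close>
  define \<alpha> \<beta> where "\<alpha> = (l - s) * p' - s * p" and "\<beta> = s * q - (l - s) * q'"
  have lin: "lin \<alpha> \<beta> n i = l - s" "lin \<alpha> \<beta> n (Suc i) = s"
    using det unfolding lin_def \<alpha>_def \<beta>_def q_def[symmetric] p_def[symmetric] q'_def[symmetric] p'_def[symmetric]
    by algebra+
  have "cosh (l - s) = cosh (s - l)" by (metis cosh_minus minus_diff_eq)
  then show ?thesis
    using s by (intro exI[of _ \<alpha>] exI[of _ \<beta>]) (simp add: tangent_def refine_simps lin l w_def[symmetric])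
qed

definition tangent_pair :: "nat \<Rightarrow> nat \<Rightarrow> real \<Rightarrow> real \<Rightarrow> bool" where
  "tangent_pair n i \<alpha> \<beta> \<longleftrightarrow> tangent n i (Suc i) i \<alpha> \<beta> \<and> tangent n i (i - 1) (i - 1) \<alpha> \<beta>"

lemma tangent_pair_refine:
  assumes "0 < i" "i < 2 ^ n" "tangent_pair n i \<alpha> \<beta>"
  shows "tangent_pair (Suc n) (2 * i) \<alpha> \<beta>"
  using tangent_refine_right[of i n \<alpha> \<beta>] tangent_refine_left[of "i - 1" n \<alpha> \<beta>] assms
  by (cases i) (auto simp: tangent_pair_def)

text \<open>An odd index is a fresh mediant; an even one comes from a coarser chain, whose form
  survives refinement.\<close>

lemma tangent_pair_exists: "0 < i \<Longrightarrow> i < 2 ^ n \<Longrightarrow> \<exists>\<alpha> \<beta>. tangent_pair n i \<alpha> \<beta>"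
proof (induction n arbitrary: i)
  case (Suc n)
  show ?case
  proof (cases "even i")
    case True
    then obtain j where "i = 2 * j" by blast
    then show ?thesis using Suc.IH[of j] Suc.prems tangent_pair_refine[of j n] by auto
  next
    case False
    then obtain j where "i = Suc (2 * j)" by (metis oddE Suc_eq_plus1)
    then show ?thesis using tangent_mediant_exists[of j n] Suc.prems by (auto simp: tangent_pair_def)
  qed
qed simp

lemma tangent_pair_refines:
  assumes "0 < i" "i < 2 ^ n" "tangent_pair n i \<alpha> \<beta>"
  shows "tangent_pair (n + m) (2 ^ m * i) \<alpha> \<beta>"
proof (induction m)
  case (Suc m)
  then show ?case
    using tangent_pair_refine[of "2 ^ m * i" "n + m" \<alpha> \<beta>] assms by (simp add: power_add mult.assoc)
qed (use assms in simp)

text \<open>Strictness stems from \<open>sinh l < cosh l\<close>, which turns the tangent relation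
  into \<open>cosh y < cosh_len n j\<close>.\<close>

lemma lin_less_len:
  assumes "tangent n i j k \<alpha> \<beta>" "i \<le> 2 ^ n" "j \<le> 2 ^ n"
  shows "lin \<alpha> \<beta> n j < len n j"
proof -
  define l y where "l = len n i" and "y = lin \<alpha> \<beta> n j"
  have l: "0 < sinh l" "sinh l < cosh l" using len_pos[OF assms(2)] sinh_less_cosh_real by (auto simp: l_def)
  have "cosh_len n j * sinh l = cosh l * cosh y" using assms by (simp add: tangent_def l_def y_def)
  moreover have "sinh l * cosh y < cosh l * cosh y" using l by simp
  \<comment> \<open>The form may be negative at \<open>j\<close>, whereas \<open>cosh\<close> is
    increasing on non-negative arguments.\<close>
  ultimately have "sinh l * cosh \<bar>y\<bar> < sinh l * cosh_len n j" by (simp add: mult.commute cosh_real_abs)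
  then have "cosh \<bar>y\<bar> < cosh (len n j)" using l assms by simp
  then show ?thesis using len_pos[OF assms(3)] cosh_real_nonneg_less_iff[of "\<bar>y\<bar>" "len n j"]
    by (simp add: y_def)
qed

text \<open>
  With \<open>H\<close> the difference between \<open>F\<close> and the linear form and \<open>D\<close> the determinant against
  \<open>(q 0, p 0)\<close>, convexity says that \<open>H / D\<close> is non-decreasing along the chain.
\<close>

lemma above_tangent_along_chain:
  fixes q p F :: "nat \<Rightarrow> real"
  assumes det: "\<And>j. j < N \<Longrightarrow> q j * p (Suc j) - p j * q (Suc j) = 1"
    and pos: "\<And>j. j \<le> N \<Longrightarrow> 0 < q j"
    and conv: "\<And>j. Suc j < N \<Longrightarrow> \<exists>\<alpha> \<beta>. \<alpha> * q j + \<beta> * p j \<le> F j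
      \<and> F (Suc j) = \<alpha> * q (Suc j) + \<beta> * p (Suc j)
      \<and> \<alpha> * q (Suc (Suc j)) + \<beta> * p (Suc (Suc j)) \<le> F (Suc (Suc j))"
    and base: "F 0 = \<alpha> * q 0 + \<beta> * p 0" "\<alpha> * q (Suc 0) + \<beta> * p (Suc 0) < F (Suc 0)"
    and j: "j < N"
  shows "\<alpha> * q (Suc j) + \<beta> * p (Suc j) < F (Suc j)"
proof -
  define H where "H j = F j - (\<alpha> * q j + \<beta> * p j)" for j
  define D where "D j = q 0 * p j - p 0 * q j" for j
  have "0 < H (Suc j) \<and> 0 \<le> D j \<and> 0 < D (Suc j) \<and> H j * D (Suc j) \<le> H (Suc j) * D j"
    using j
  proof (induction j)
    case 0
    then show ?case using base det[of 0] by (simp add: H_def D_def)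
  next
    case (Suc j)
    \<comment> \<open>By unimodularity the outer two of three successive vectors add up to
      \<open>k\<close> times the middle one.\<close>
    define k where "k = q j * p (Suc (Suc j)) - p j * q (Suc (Suc j))"
    have d: "q j * p (Suc j) - p j * q (Suc j) = 1"
      "q (Suc j) * p (Suc (Suc j)) - p (Suc j) * q (Suc (Suc j)) = 1"
      using det[of j] det[of "Suc j"] Suc.prems by auto
    have k: "q j + q (Suc (Suc j)) = k * q (Suc j)" "p j + p (Suc (Suc j)) = k * p (Suc j)"
      unfolding k_def using d by algebra+
    have "D (Suc (Suc j)) * q (Suc j) = D (Suc j) * q (Suc (Suc j)) + q 0"
      unfolding D_def using d by algebra
    moreover have "0 < q 0" "0 < q (Suc j)" "0 < q (Suc (Suc j))" using pos Suc.prems by auto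
    ultimately have "0 < D (Suc (Suc j)) * q (Suc j)" using Suc by (simp add: add_pos_pos)
    then have D2: "0 < D (Suc (Suc j))" using \<open>0 < q (Suc j)\<close> by (simp add: zero_less_mult_iff)
    obtain a b where ab: "a * q j + b * p j \<le> F j" "F (Suc j) = a * q (Suc j) + b * p (Suc j)"
      "a * q (Suc (Suc j)) + b * p (Suc (Suc j)) \<le> F (Suc (Suc j))"
      using conv[OF Suc.prems] by blast
    \<comment> \<open>The form supporting \<open>F\<close> at the middle vector is evaluated on this
      sum, whence \<open>k * F (Suc j) \<le> F j + F (Suc (Suc j))\<close>.\<close>
    have "k * F (Suc j) = (a * q j + b * p j) + (a * q (Suc (Suc j)) + b * p (Suc (Suc j)))"
      using k ab(2) by algebra
    then have "k * F (Suc j) \<le> F j + F (Suc (Suc j))" using ab by linarith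
    moreover have "k * H (Suc j) - (H j + H (Suc (Suc j))) = k * F (Suc j) - (F j + F (Suc (Suc j)))"
      unfolding H_def using k by algebra
    ultimately have "k * H (Suc j) - H j \<le> H (Suc (Suc j))" by linarith
    then have *: "(k * H (Suc j) - H j) * D (Suc j) \<le> H (Suc (Suc j)) * D (Suc j)"
      using Suc by (intro mult_right_mono) auto
    have D_rec: "D (Suc (Suc j)) = k * D (Suc j) - D j" unfolding D_def using k by algebra
    \<comment> \<open>\<open>D\<close> satisfies with equality the recursion that \<open>H\<close>
      satisfies as an inequality; the induction hypothesis compares the remaining terms.\<close>
    have slope: "H (Suc j) * D (Suc (Suc j)) \<le> H (Suc (Suc j)) * D (Suc j)"
    proof -
      have "H (Suc j) * D (Suc (Suc j)) = k * H (Suc j) * D (Suc j) - H (Suc j) * D j"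
        unfolding D_rec by (simp add: algebra_simps)
      moreover have "(k * H (Suc j) - H j) * D (Suc j) = k * H (Suc j) * D (Suc j) - H j * D (Suc j)"
        by (simp add: algebra_simps)
      ultimately show ?thesis using * Suc by linarith
    qed
    moreover have "0 < H (Suc j) * D (Suc (Suc j))" using D2 Suc by simp
    ultimately have "0 < H (Suc (Suc j)) * D (Suc j)" by linarith
    then have "0 < H (Suc (Suc j))" using Suc by (simp add: zero_less_mult_iff)
    then show ?case using slope D2 Suc by simp
  qed
  then show ?thesis by (simp add: H_def)
qed

section \<open>Support of the length function along whole chains\<close>

lemma farey_det_real:
  "i < 2 ^ n \<Longrightarrow> real_of_int (farey_den n i) * real_of_int (farey_num n (Suc i))
    - real_of_int (farey_num n i) * real_of_int (farey_den n (Suc i)) = 1"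
  using farey_det[of i n] by (metis of_int_1 of_int_diff of_int_mult)

lemma convex_at:
  assumes "Suc j < 2 ^ n"
  shows "\<exists>\<alpha> \<beta>. lin \<alpha> \<beta> n j \<le> len n j \<and> len n (Suc j) = lin \<alpha> \<beta> n (Suc j)
    \<and> lin \<alpha> \<beta> n (Suc (Suc j)) \<le> len n (Suc (Suc j))"
proof -
  obtain \<alpha> \<beta> where "tangent_pair n (Suc j) \<alpha> \<beta>" using tangent_pair_exists assms by blast
  then have "tangent n (Suc j) (Suc (Suc j)) (Suc j) \<alpha> \<beta>" "tangent n (Suc j) j j \<alpha> \<beta>"
    by (auto simp: tangent_pair_def)
  from lin_less_len[OF this(1)] lin_less_len[OF this(2)] this assms show ?thesis
    by (intro exI[of _ \<alpha>] exI[of _ \<beta>]) (auto simp: tangent_def)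
qed

lemma len_above_right:
  assumes "tangent n i (Suc i) i \<alpha> \<beta>" "i < j" "j \<le> 2 ^ n"
  shows "lin \<alpha> \<beta> n j < len n j"
proof -
  obtain k where k: "j = i + Suc k" using assms(2) by (metis add_Suc_right less_iff_Suc_add)
  have i: "i \<le> 2 ^ n" using assms by simp
  have "\<alpha> * real_of_int (farey_den n (i + Suc k)) + \<beta> * real_of_int (farey_num n (i + Suc k)) < len n (i + Suc k)"
  \<comment> \<open>The chain is restarted at entry \<open>i\<close>, where the tangent form is
    exact.\<close>
  proof (rule above_tangent_along_chain[where N = "2 ^ n - i"])
    show "\<exists>\<alpha> \<beta>. \<alpha> * real_of_int (farey_den n (i + j)) + \<beta> * real_of_int (farey_num n (i + j)) \<le> len n (i + j) \<and>
        len n (i + Suc j) = \<alpha> * real_of_int (farey_den n (i + Suc j)) + \<beta> * real_of_int (farey_num n (i + Suc j)) \<and>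
        \<alpha> * real_of_int (farey_den n (i + Suc (Suc j))) + \<beta> * real_of_int (farey_num n (i + Suc (Suc j)))
          \<le> len n (i + Suc (Suc j))"
      if "Suc j < 2 ^ n - i" for j
      using convex_at[of "i + j" n] that by (simp add: lin_def)
    show "0 < real_of_int (farey_den n (i + j))" if "j \<le> 2 ^ n - i" for j
    proof -
      have "i + j \<le> 2 ^ n" using that i by linarith
      then show ?thesis using farey_bounds[of "i + j" n] by simp
    qed
  qed (use assms k farey_det_real lin_less_len[OF assms(1)] in \<open>auto simp: lin_def tangent_def\<close>)
  then show ?thesis by (simp add: k lin_def)
qed

text \<open>Reading the chain leftwards reverses the sign of the determinants; negating the
  numerators together with \<open>\<beta>\<close> restores it.\<close>

lemma len_above_left:
  assumes "tangent n i (i - 1) (i - 1) \<alpha> \<beta>" "j < i" "i \<le> 2 ^ n"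
  shows "lin \<alpha> \<beta> n j < len n j"
proof -
  define k where "k = i - Suc j"
  have k: "j = i - Suc k" "k < i" using assms(2) by (auto simp: k_def)
  have "\<alpha> * real_of_int (farey_den n (i - Suc k)) + (- \<beta>) * (- real_of_int (farey_num n (i - Suc k))) < len n (i - Suc k)"
  proof (rule above_tangent_along_chain[where N = i])
    show "\<exists>\<alpha> \<beta>. \<alpha> * real_of_int (farey_den n (i - j)) + \<beta> * (- real_of_int (farey_num n (i - j))) \<le> len n (i - j) \<and>
        len n (i - Suc j) = \<alpha> * real_of_int (farey_den n (i - Suc j)) + \<beta> * (- real_of_int (farey_num n (i - Suc j))) \<and>
        \<alpha> * real_of_int (farey_den n (i - Suc (Suc j))) + \<beta> * (- real_of_int (farey_num n (i - Suc (Suc j))))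
          \<le> len n (i - Suc (Suc j))"
      if j: "Suc j < i" for j
    proof -
      have lt: "i - Suc j < 2 ^ n" using j assms(3) by linarith
      have e: "Suc (i - Suc (Suc j)) = i - Suc j" "Suc (i - Suc j) = i - j" using j by auto
      obtain a b where "lin a b n (i - Suc (Suc j)) \<le> len n (i - Suc (Suc j))"
        "len n (i - Suc j) = lin a b n (i - Suc j)" "lin a b n (i - j) \<le> len n (i - j)"
        using convex_at[of "i - Suc (Suc j)" n] lt unfolding e by auto
      then show ?thesis by (intro exI[of _ a] exI[of _ "- b"]) (simp add: lin_def)
    qed
    show "0 < real_of_int (farey_den n (i - j))" for j
    proof -
      have "i - j \<le> 2 ^ n" using assms(3) by linarith
      then show ?thesis using farey_bounds[of "i - j" n] by simp
    qed
    show "real_of_int (farey_den n (i - j)) * - real_of_int (farey_num n (i - Suc j))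
        - - real_of_int (farey_num n (i - j)) * real_of_int (farey_den n (i - Suc j)) = 1" if "j < i" for j
      using farey_det_real[of "i - Suc j" n] that assms by (simp add: Suc_diff_Suc mult.commute)
  qed (use assms k lin_less_len[OF assms(1)] in \<open>auto simp: lin_def tangent_def\<close>)
  then show ?thesis by (simp add: k lin_def)
qed

section \<open>Lengths of pairs and their support functionals\<close>

definition markov_length :: "int \<Rightarrow> int \<Rightarrow> real" where
  "markov_length q p = arcosh (3 / 2 * real_of_int (markov p q))"

lemma len_eq: "len n i = markov_length (farey_den n i) (farey_num n i)"
  by (simp add: len_def cosh_len_def farey_markov_def markov_length_def)

lemma markov_pairs_farey:
  assumes "(q, p) \<in> markov_pairs"
  obtains n i where "i \<le> 2 ^ n" "farey_den n i = q" "farey_num n i = p"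
  using farey_exists[of p q] assms by (auto simp: markov_pairs_def coprime_commute)

lemma markov_pos:
  assumes "(q, p) \<in> markov_pairs"
  shows "1 \<le> markov p q"
proof -
  obtain n i where "i \<le> 2 ^ n" "farey_den n i = q" "farey_num n i = p"
    using markov_pairs_farey[OF assms] by blast
  then show ?thesis using cosh_len_gt_1[of i n] by (simp add: cosh_len_def farey_markov_def)
qed

lemma farey_end: "farey_num n 0 = 0" "farey_den n 0 = 1" "farey_den n (2 ^ n) = 1"
  by (induction n) auto

text \<open>The bound on \<open>q\<close> makes the entry interior, so that one form is tangent on
  both sides; a common refinement puts the two pairs into one chain.\<close>

lemma markov_length_support:
  assumes w: "(q, p) \<in> markov_pairs" and q: "2 \<le> q"
  obtains \<alpha> \<beta> where "markov_length q p = \<alpha> * q + \<beta> * p"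
    "\<And>q' p'. (q', p') \<in> markov_pairs \<Longrightarrow> (q', p') \<noteq> (q, p) \<Longrightarrow> \<alpha> * q' + \<beta> * p' < markov_length q' p'"
proof -
  obtain n i where i: "i \<le> 2 ^ n" "farey_den n i = q" "farey_num n i = p"
    using markov_pairs_farey[OF w] by blast
  have "i \<noteq> 0" by (rule notI) (use i q farey_end(2)[of n] in simp)
  moreover have "i \<noteq> 2 ^ n" by (rule notI) (use i q farey_end(3)[of n] in simp)
  ultimately have i': "0 < i" "i < 2 ^ n" using i by auto
  obtain \<alpha> \<beta> where t: "tangent_pair n i \<alpha> \<beta>" using tangent_pair_exists[OF i'] by blast
  show ?thesis
  proof
    show "markov_length q p = \<alpha> * q + \<beta> * p"
      using t i by (simp add: tangent_pair_def tangent_def lin_def len_eq)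
  next
    fix q' p' assume v: "(q', p') \<in> markov_pairs" "(q', p') \<noteq> (q, p)"
    obtain m j where j: "j \<le> 2 ^ m" "farey_den m j = q'" "farey_num m j = p'"
      using markov_pairs_farey[OF v(1)] by blast
    define N I J where "N = n + m" and "I = 2 ^ m * i" and "J = 2 ^ n * j"
    have I: "farey_den N I = q" "farey_num N I = p" using farey_refine[of n m i] i by (simp_all add: N_def I_def)
    have J: "farey_den N J = q'" "farey_num N J = p'"
      using farey_refine[of m n j] j by (simp_all add: N_def J_def add.commute)
    have IJ: "I \<noteq> J" using I J v by auto
    have le: "I \<le> 2 ^ N" "J \<le> 2 ^ N" using i j by (simp_all add: N_def I_def J_def power_add)
    have T: "tangent_pair N I \<alpha> \<beta>" using tangent_pair_refines[OF i' t] by (simp add: N_def I_def)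
    have "lin \<alpha> \<beta> N J < len N J"
      using IJ T le len_above_right[of N I \<alpha> \<beta> J] len_above_left[of N I \<alpha> \<beta> J]
      by (cases "I < J") (auto simp: tangent_pair_def)
    then show "\<alpha> * q' + \<beta> * p' < markov_length q' p'" by (simp add: lin_def len_eq J)
  qed
qed

text \<open>At the end 0/1 the tangent form is explicit: \<open>l * q + l / 2 * p\<close> with
  \<open>cosh l = 3 / 2\<close>. It is tangent because \<open>cosh (l / 2) = sinh l\<close>, both
  squares being 5/4.\<close>

lemma markov_length_lower_bound:
  assumes "(q, p) \<in> markov_pairs" "0 < p"
  shows "arcosh (3 / 2) * q < markov_length q p"
proof -
  define l :: real where "l = arcosh (3 / 2)"
  have l: "cosh l = 3 / 2" "l > 0" by (simp_all add: l_def)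
  have half: "(cosh (l / 2))\<^sup>2 = 5 / 4" "cosh (3 * l / 2) = 2 * cosh (l / 2)"
  proof -
    have "cosh l = 2 * (cosh (l / 2))\<^sup>2 - 1" using cosh_double_cosh[of "l / 2"] by simp
    then show h: "(cosh (l / 2))\<^sup>2 = 5 / 4" using l by simp
    have "cosh (3 * l / 2) + cosh (l / 2) = cosh (l + l / 2) + cosh (l - l / 2)" by (simp add: field_simps)
    also have "\<dots> = 2 * cosh l * cosh (l / 2)" unfolding cosh_add cosh_diff by (simp add: algebra_simps)
    finally show "cosh (3 * l / 2) = 2 * cosh (l / 2)" using l by simp
  qed
  have "cosh (l / 2) = sinh l"
  proof -
    have "(cosh l)\<^sup>2 = 9 / 4" unfolding l by (simp add: power_divide)
    then have "(sinh l)\<^sup>2 = (cosh (l / 2))\<^sup>2" using half by (simp add: sinh_square_eq)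
    then show ?thesis using l by (auto simp: power2_eq_iff dest: sym) (smt (verit) cosh_real_pos sinh_real_pos_iff)
  qed
  then have "tangent 0 0 (Suc 0) 0 l (l / 2)"
    using half l by (simp add: tangent_def lin_def len_def cosh_len_def cosh_diff_len_def farey_markov_0 flip: l_def)
  then have T: "tangent n 0 (Suc 0) 0 l (l / 2)" for n
    using tangent_refine_right[of 0] by (induction n) auto
  obtain n i where i: "i \<le> 2 ^ n" "farey_den n i = q" "farey_num n i = p"
    using markov_pairs_farey[OF assms(1)] by blast
  have "i \<noteq> 0" by (rule notI) (use i assms(2) farey_end(1)[of n] in simp)
  then have "lin l (l / 2) n i < len n i" using len_above_right[OF T] i by auto
  then have "l * q + l / 2 * p < markov_length q p" by (simp add: lin_def len_eq i)
  moreover have "0 < l / 2 * p" using l assms by simp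
  ultimately show ?thesis by (simp add: l_def)
qed

section \<open>One-sided derivatives of convex functions given on the rationals\<close>

text \<open>The infimum of the chord slopes to the right is a subgradient, and the slopes decrease
  to it as the chord shrinks.\<close>

lemma convex_on_right_derivative:
  fixes g :: "real \<Rightarrow> real"
  assumes "convex_on {a<..<b} g" "a < x" "x < b"
  obtains D where "(g has_real_derivative D) (at_right x)"
    "\<And>y. a < y \<Longrightarrow> y < b \<Longrightarrow> g x + D * (y - x) \<le> g y"
proof -
  define I where "I = {a<..<b}"
  define sl where "sl t = (g x - g t) / (x - t)" for t
  define D where "D = Inf (sl ` ({x<..} \<inter> I))"
  have sub: "g x + D * (y - x) \<le> g y" if "y \<in> I" for y
    using convex_le_Inf_differential[of I g x y] assms that
    by (simp add: I_def D_def sl_def)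
  have lower: "D \<le> sl t" if "t \<in> I" "x < t" for t
    using sub[OF that(1)] that(2) by (simp add: sl_def field_simps)
  have "((\<lambda>y. (g y - g x) / (y - x)) \<longlongrightarrow> D) (at_right x)"
  proof (rule order_tendstoI)
    fix e assume "e < D"
    have "\<forall>\<^sub>F y in at_right x. y \<in> {x<..<b}"
      using assms by (intro eventually_at_right_real) auto
    then show "\<forall>\<^sub>F y in at_right x. e < (g y - g x) / (y - x)"
    proof eventually_elim
      case (elim y)
      then have "D \<le> sl y" using assms by (intro lower) (auto simp: I_def)
      moreover have "sl y = (g y - g x) / (y - x)"
        by (simp add: sl_def) (metis minus_diff_eq minus_divide_divide)
      ultimately show ?case using \<open>e < D\<close> by simp
    qed
  next
    fix e assume e: "D < e"
    have "(x + b) / 2 \<in> {x<..} \<inter> I" using assms by (auto simp: I_def)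
    then obtain t where t: "t \<in> I" "x < t" "sl t < e"
      using cInf_lessD[of "sl ` ({x<..} \<inter> I)" e] e unfolding D_def by blast
    have "\<forall>\<^sub>F y in at_right x. y \<in> {x<..<t}"
      using t by (intro eventually_at_right_real) auto
    then show "\<forall>\<^sub>F y in at_right x. (g y - g x) / (y - x) < e"
    proof eventually_elim
      case (elim y)
      then have "sl y \<le> sl t"
        using convex_on_slope_le(1)[OF assms(1), of x t y] t assms by (auto simp: I_def sl_def)
      moreover have "sl y = (g y - g x) / (y - x)"
        by (simp add: sl_def) (metis minus_diff_eq minus_divide_divide)
      ultimately show ?case using t by simp
    qed
  qed
  then have "(g has_real_derivative D) (at_right x)" by (simp add: has_field_derivative_iff)
  then show ?thesis using sub that by (auto simp: I_def)
qed

text \<open>Reflection \<open>y \<mapsto> - y\<close> reduces this to the right-hand case.\<close>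

lemma convex_on_left_derivative:
  fixes g :: "real \<Rightarrow> real"
  assumes "convex_on {a<..<b} g" "a < x" "x < b"
  obtains D where "(g has_real_derivative D) (at_left x)"
    "\<And>y. a < y \<Longrightarrow> y < b \<Longrightarrow> g x + D * (y - x) \<le> g y"
proof -
  have "convex_on {-b<..<-a} (\<lambda>y. g (- y))"
  proof (rule convex_onI)
    fix t u v :: real
    assume "0 < t" "t < 1" "u \<in> {-b<..<-a}" "v \<in> {-b<..<-a}"
    then show "g (- ((1 - t) *\<^sub>R u + t *\<^sub>R v)) \<le> (1 - t) * g (- u) + t * g (- v)"
      using convex_onD[OF assms(1), of t "-u" "-v"] by (simp add: algebra_simps)
  qed simp
  then obtain D where D: "((\<lambda>y. g (- y)) has_real_derivative D) (at_right (- x))"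
    "\<And>y. -b < y \<Longrightarrow> y < -a \<Longrightarrow> g x + D * (y + x) \<le> g (- y)"
    using convex_on_right_derivative[of "-b" "-a" "\<lambda>y. g (- y)" "-x"] assms by auto
  have "((\<lambda>y. (g y - g x) / (y - x)) \<longlongrightarrow> - D) (at_left x)"
  proof -
    have "((\<lambda>y. - ((g (- y) - g x) / (y + x))) \<longlongrightarrow> - D) (at_right (- x))"
      using D(1) by (intro tendsto_minus) (simp add: has_field_derivative_iff)
    also have "(\<lambda>y. - ((g (- y) - g x) / (y + x))) = (\<lambda>y. (g (- y) - g x) / (- y - x))"
      by (rule ext) (metis minus_divide_right minus_add_distrib diff_conv_add_uminus)
    finally show ?thesis by (simp add: at_left_minus[of x] filterlim_filtermap)
  qed
  then have "(g has_real_derivative - D) (at_left x)" by (simp add: has_field_derivative_iff)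
  moreover have "g x + - D * (y - x) \<le> g y" if "a < y" "y < b" for y
    using D(2)[of "- y"] that by (simp add: algebra_simps)
  ultimately show ?thesis using that by blast
qed

definition rat_support :: "(real \<Rightarrow> real) \<Rightarrow> real \<Rightarrow> real \<Rightarrow> bool" where
  "rat_support f a b \<longleftrightarrow> (\<forall>t\<in>\<rat> \<inter> {a<..<b}. \<exists>D. \<forall>s\<in>\<rat> \<inter> {a..b}. s \<noteq> t \<longrightarrow> f t + D * (s - t) < f s)"

text \<open>The extension is the supremum of the support lines. At a rational its own line attains
  it; on the interval all lines stay below the larger end value.\<close>

lemma convex_extension_of_rat_support:
  fixes f :: "real \<Rightarrow> real"
  assumes "a \<in> \<rat>" "b \<in> \<rat>" "a < b" and supp: "rat_support f a b"
  obtains g where "convex_on {a<..<b} g" "\<And>t. t \<in> \<rat> \<inter> {a<..<b} \<Longrightarrow> g t = f t"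
proof -
  define Q where "Q = \<rat> \<inter> {a<..<b}"
  have "\<forall>t\<in>Q. \<exists>D. \<forall>s\<in>\<rat> \<inter> {a..b}. s \<noteq> t \<longrightarrow> f t + D * (s - t) < f s"
    using supp by (auto simp: rat_support_def Q_def)
  then obtain D where D: "\<And>t s. t \<in> Q \<Longrightarrow> s \<in> \<rat> \<inter> {a..b} \<Longrightarrow> s \<noteq> t \<Longrightarrow> f t + D t * (s - t) < f s"
    by metis
  define A where "A t x = f t + D t * (x - t)" for t x
  have A_le: "A t s \<le> f s" if "t \<in> Q" "s \<in> \<rat> \<inter> {a..b}" for t s
    using D[OF that] by (cases "s = t") (auto simp: A_def)
  have "A t x \<le> max (f a) (f b)" if t: "t \<in> Q" and x: "x \<in> {a<..<b}" for t x
  proof (cases "D t \<ge> 0")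
    case True
    then have "D t * (x - t) \<le> D t * (b - t)" using x by (intro mult_left_mono) auto
    then show ?thesis using A_le[OF t, of b] assms by (auto simp: A_def)
  next
    case False
    then have "D t * (x - t) \<le> D t * (a - t)" using x by (intro mult_left_mono_neg) auto
    then show ?thesis using A_le[OF t, of a] assms by (auto simp: A_def)
  qed
  then have bdd: "bdd_above ((\<lambda>t. A t x) ` Q)" if "x \<in> {a<..<b}" for x
    using that by (intro bdd_aboveI[of _ "max (f a) (f b)"]) auto
  have ne: "Q \<noteq> {}" using Rats_dense_in_real[OF \<open>a < b\<close>] by (auto simp: Q_def)
  define G where "G x = (SUP t\<in>Q. A t x)" for x
  have "convex_on {a<..<b} G"
  proof (rule convex_onI)
    fix u x y :: real
    assume u: "0 < u" "u < 1" and x: "x \<in> {a<..<b}" and y: "y \<in> {a<..<b}"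
    show "G ((1 - u) *\<^sub>R x + u *\<^sub>R y) \<le> (1 - u) * G x + u * G y"
      unfolding G_def
    proof (rule cSUP_least[OF ne])
      fix t assume t: "t \<in> Q"
      have "A t ((1 - u) *\<^sub>R x + u *\<^sub>R y) = (1 - u) * A t x + u * A t y"
        by (simp add: A_def algebra_simps)
      also have "\<dots> \<le> (1 - u) * (SUP t\<in>Q. A t x) + u * (SUP t\<in>Q. A t y)"
        using u by (intro add_mono mult_left_mono cSUP_upper t bdd x y) auto
      finally show "A t ((1 - u) *\<^sub>R x + u *\<^sub>R y) \<le> \<dots>" .
    qed
  qed simp
  moreover have "G t = f t" if t: "t \<in> \<rat> \<inter> {a<..<b}" for t
  proof (rule antisym)
    show "G t \<le> f t" unfolding G_def using t by (intro cSUP_least[OF ne] A_le) auto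
    have "A t t \<le> G t" unfolding G_def using t by (intro cSUP_upper bdd) (auto simp: Q_def)
    then show "f t \<le> G t" by (simp add: A_def)
  qed
  ultimately show ?thesis using that by blast
qed

text \<open>A chord lying on a tangent would force the support line at a point in between to touch twice.\<close>

lemma rat_support_strict:
  fixes f :: "real \<Rightarrow> real"
  assumes supp: "rat_support f a b" and t: "t \<in> \<rat> \<inter> {a<..<b}"
    and sub: "\<And>r. r \<in> \<rat> \<inter> {a<..<b} \<Longrightarrow> f t + D * (r - t) \<le> f r"
    and s: "s \<in> \<rat> \<inter> {a..b}" "s \<noteq> t"
  shows "f t + D * (s - t) < f s"
proof -
  have "\<exists>r\<in>\<rat>. min s t < r \<and> r < max s t" using s by (intro Rats_dense_in_real) auto
  then obtain r where r: "r \<in> \<rat>" "min s t < r" "r < max s t" by blast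
  have rI: "r \<in> \<rat> \<inter> {a<..<b}" using r s t by auto
  then obtain E where E: "\<And>s. s \<in> \<rat> \<inter> {a..b} \<Longrightarrow> s \<noteq> r \<Longrightarrow> f r + E * (s - r) < f s"
    using supp unfolding rat_support_def by blast
  have 1: "f r + E * (s - r) < f s" "f r + E * (t - r) < f t" using r t s by (auto intro!: E)
  have 2: "f t + D * (r - t) \<le> f r" using sub[OF rI] .
  have "(E - D) * (r - t) > 0" using 1 2 by (simp add: algebra_simps)
  \<comment> \<open>As \<open>r\<close> lies between \<open>t\<close> and \<open>s\<close>, the line
    of slope \<open>E\<close> through the point at \<open>r\<close> is above the given line at
    \<open>s\<close>.\<close>
  moreover have "(r - t > 0 \<and> s - r > 0) \<or> (r - t < 0 \<and> s - r < 0)" using r by auto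
  ultimately have "(E - D) * (s - r) > 0" by (auto simp: zero_less_mult_iff)
  then show ?thesis using 1 2 by (simp add: algebra_simps)
qed

section \<open>One-sided derivatives of Fock's function\<close>

lemma DERIV_right_unique:
  "(f has_real_derivative D) (at_right x) \<Longrightarrow> right_deriv f x = D"
  unfolding right_deriv_def has_field_derivative_iff
  by (rule some_equality) (auto intro: tendsto_unique[rotated])

lemma DERIV_left_unique:
  "(f has_real_derivative D) (at_left x) \<Longrightarrow> left_deriv f x = D"
  unfolding left_deriv_def has_field_derivative_iff
  by (rule some_equality) (auto intro: tendsto_unique[rotated])

text \<open>At an irrational point, continuity of the convex \<open>g\<close> shows that the limit
  defining \<open>fock\<close> exists and equals \<open>g x\<close>.\<close>

lemma fock_eq_convex:
  assumes g: "convex_on {0<..<1/2} g" "\<And>t. t \<in> \<rat> \<inter> {0<..<1/2} \<Longrightarrow> g t = fock t"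
    and x: "0 < x" "x < 1/2"
  shows "fock x = g x"
proof (cases "x \<in> \<rat>")
  case False
  define F where "F = at x within \<rat> \<inter> {0..1/2}"
  have "continuous_on {0<..<1/2} g" using g(1) by (intro convex_on_continuous) auto
  then have "isCont g x" using x continuous_on_eq_continuous_at[of "{0<..<1/2}" g] by auto
  then have lim: "(g \<longlongrightarrow> g x) F" unfolding isCont_def F_def by (rule tendsto_within_subset) auto
  have "\<forall>\<^sub>F s in F. s \<in> {0<..<1/2}"
    unfolding F_def eventually_at_filter using eventually_nhds_in_open[of "{0<..<1/2}" x] x
    by (auto elim!: eventually_mono)
  moreover have "\<forall>\<^sub>F s in F. s \<in> \<rat>" unfolding F_def by (auto simp: eventually_at_filter)
  ultimately have "\<forall>\<^sub>F s in F. g s = fock_rat (inv real_of_rat s)"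
    by eventually_elim (use g(2) in \<open>auto simp: fock_def\<close>)
  with lim have lim': "((\<lambda>s. fock_rat (inv real_of_rat s)) \<longlongrightarrow> g x) F"
    by (rule Lim_transform_eventually)
  \<comment> \<open>Rationals accumulate at \<open>x\<close>, so limits along the filter are
    unique.\<close>
  have "x islimpt (\<rat> \<inter> {0..1/2})"
    unfolding islimpt_approachable
  proof (intro allI impI)
    fix e :: real assume "e > 0"
    then have "x < min (x + e) (1/2)" using x by auto
    then obtain r where "r \<in> \<rat>" "x < r" "r < min (x + e) (1/2)" using Rats_dense_in_real by blast
    then show "\<exists>r\<in>\<rat> \<inter> {0..1/2}. r \<noteq> x \<and> dist r x < e"
      using x by (intro bexI[of _ r]) (auto simp: dist_real_def)
  qed
  then have "F \<noteq> bot" unfolding F_def by (simp add: trivial_limit_within)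
  then have "Lim F (\<lambda>s. fock_rat (inv real_of_rat s)) = g x" using lim' by (intro tendsto_Lim)
  then show ?thesis using False by (simp add: fock_def F_def)
qed (use g(2) x in auto)

text \<open>Near \<open>t\<close> the function agrees with a convex one, so the derivatives named by
  choice exist and are subgradients; \<open>rat_support_strict\<close> adds strictness and the
  ends.\<close>

lemma fock_one_sided_derivatives:
  assumes supp: "rat_support fock 0 (1/2)" and t: "t \<in> \<rat>" "0 < t" "t < 1/2"
    and D: "D = right_deriv fock t \<or> D = left_deriv fock t"
    and s: "s \<in> \<rat>" "0 \<le> s" "s \<le> 1/2" "s \<noteq> t"
  shows "fock t + D * (s - t) < fock s"
proof -
  obtain g where g: "convex_on {0<..<1/2} g" "\<And>t. t \<in> \<rat> \<inter> {0<..<1/2} \<Longrightarrow> g t = fock t"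
    using convex_extension_of_rat_support[OF _ _ _ supp] by auto
  have eq: "fock x = g x" if "0 < x" "x < 1/2" for x
    using fock_eq_convex[OF g that] .
  have ev: "\<forall>\<^sub>F x in nhds t. g x = fock x"
    using eventually_nhds_in_open[of "{0<..<1/2}" t] t by (auto elim!: eventually_mono simp: eq)
  obtain R where R: "(g has_real_derivative R) (at_right t)"
    "\<And>y. 0 < y \<Longrightarrow> y < 1/2 \<Longrightarrow> g t + R * (y - t) \<le> g y"
    using convex_on_right_derivative[OF g(1) t(2,3)] by blast
  obtain L where L: "(g has_real_derivative L) (at_left t)"
    "\<And>y. 0 < y \<Longrightarrow> y < 1/2 \<Longrightarrow> g t + L * (y - t) \<le> g y"
    using convex_on_left_derivative[OF g(1) t(2,3)] by blast
  have "right_deriv fock t = R" "left_deriv fock t = L"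
    using R(1) L(1) eq t ev
    by (auto intro!: DERIV_right_unique DERIV_left_unique
        elim!: has_field_derivative_cong_eventually[THEN iffD1, rotated 2] simp: eventually_at_filter
        elim: eventually_mono)
  then have "fock t + D * (r - t) \<le> fock r" if "r \<in> \<rat> \<inter> {0<..<1/2}" for r
    using R(2)[of r] L(2)[of r] D that t eq by auto
  then show ?thesis using rat_support_strict[OF supp, of t D s] t s by auto
qed

section \<open>Tangents of Fock's function\<close>

text \<open>\<open>T\<close> sends \<open>p/(p + q)\<close> to \<open>p/q\<close>, both reduced,
  which links \<open>fock\<close> to the length of \<open>(q, p)\<close>.\<close>

lemma fock_markov_pair:
  assumes "(q, p) \<in> markov_pairs"
  shows "fock (real_of_int p / real_of_int (p + q)) = markov_length q p / real_of_int (p + q)"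
proof -
  have pq: "0 \<le> p" "1 \<le> q" "coprime q p" using assms by (auto simp: markov_pairs_def)
  have t: "real_of_int p / real_of_int (p + q) = real_of_rat (Fract p (p + q))"
    using pq by (simp add: of_rat_rat)
  have "quotient_of (Fract p (p + q)) = (p, p + q)"
    using pq by (simp add: quotient_of_Fract Rat.normalize_def coprime_commute)
  then have "fock_rat (Fract p (p + q)) = markov_length q p / real_of_int (p + q)"
    by (simp add: fock_rat_def markov_length_def)
  moreover have "inj real_of_rat" by (simp add: inj_def)
  ultimately show ?thesis using pq t by (simp add: fock_def)
qed

lemma rat_obtain_markov_pair:
  assumes "t \<in> \<rat>" "0 \<le> t" "t \<le> 1 / 2"
  obtains q p where "(q, p) \<in> markov_pairs" "t = real_of_int p / real_of_int (p + q)"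
proof -
  obtain r where r: "t = real_of_rat r" using assms by (auto simp: Rats_def)
  obtain p n where pn: "quotient_of r = (p, n)" by fastforce
  have n: "0 < n" "coprime p n" using quotient_of_denom_pos[OF pn] quotient_of_coprime[OF pn] by auto
  have t: "t = real_of_int p / real_of_int n" using r quotient_of_div[OF pn] by (simp add: of_rat_divide)
  have "0 \<le> p" using assms(2) n by (simp add: t zero_le_divide_iff)
  moreover have "2 * real_of_int p \<le> real_of_int n" using assms(3) n by (simp add: t field_simps)
  then have "2 * p \<le> n" by linarith
  moreover have "coprime (n - p) p"
  proof (rule coprimeI)
    fix k assume "k dvd n - p" "k dvd p"
    then have "k dvd n" by (metis dvd_add diff_add_cancel)
    then show "is_unit k" using \<open>k dvd p\<close> n(2) coprime_common_divisor by blast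
  qed
  ultimately have "(n - p, p) \<in> markov_pairs" using n by (auto simp: markov_pairs_def)
  then show ?thesis using that[of "n - p" p] t by simp
qed

lemma markov_pairs_interior:
  assumes "(q, p) \<in> markov_pairs" "2 \<le> q"
  shows "1 \<le> p" "p < q"
proof -
  have pq: "0 \<le> p" "p \<le> q" "coprime q p" using assms by (auto simp: markov_pairs_def)
  have "p \<noteq> 0" "p \<noteq> q" using pq(3) assms(2) by auto
  then show "1 \<le> p" "p < q" using pq by auto
qed

text \<open>Divided by \<open>p + q\<close>, a linear form becomes an affine function of
  \<open>p/(p + q)\<close> with slope \<open>\<beta> - \<alpha>\<close>, so support forms turn into
  support lines.\<close>

lemma rat_support_fock: "rat_support fock 0 (1 / 2)"
  unfolding rat_support_def
proof
  fix t :: real assume t: "t \<in> \<rat> \<inter> {0<..<1 / 2}"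
  then obtain q p where w: "(q, p) \<in> markov_pairs" and tw: "t = real_of_int p / real_of_int (p + q)"
    using rat_obtain_markov_pair[of t] by auto
  have "q \<noteq> 1"
  proof
    assume "q = 1"
    then have "p = 0 \<or> p = 1" using w by (auto simp: markov_pairs_def)
    then show False using t \<open>q = 1\<close> by (auto simp: tw)
  qed
  then have q: "2 \<le> q" using w by (auto simp: markov_pairs_def)
  obtain \<alpha> \<beta> :: real where ab: "markov_length q p = \<alpha> * q + \<beta> * p"
    "\<And>q' p'. (q', p') \<in> markov_pairs \<Longrightarrow> (q', p') \<noteq> (q, p) \<Longrightarrow> \<alpha> * q' + \<beta> * p' < markov_length q' p'"
    using markov_length_support[OF w q] by blast
  have line: "(\<alpha> * b + \<beta> * a) / (a + b) = \<alpha> + (\<beta> - \<alpha>) * (a / (a + b))" if "a + b > 0" for a b :: real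
  proof -
    have "(\<alpha> + (\<beta> - \<alpha>) * (a / (a + b))) * (a + b) = \<alpha> * (a + b) + (\<beta> - \<alpha>) * a"
      using that by (simp add: distrib_right)
    also have "\<dots> = \<alpha> * b + \<beta> * a" by algebra
    finally show ?thesis using that by (simp add: divide_eq_eq)
  qed
  have ft: "fock t = \<alpha> + (\<beta> - \<alpha>) * t"
    using line[of "real_of_int p" "real_of_int q"] w fock_markov_pair[OF w]
    by (auto simp: markov_pairs_def tw ab(1))
  show "\<exists>D. \<forall>s\<in>\<rat> \<inter> {0..1 / 2}. s \<noteq> t \<longrightarrow> fock t + D * (s - t) < fock s"
  proof (intro exI ballI impI)
    fix s assume s: "s \<in> \<rat> \<inter> {0..1 / 2}" "s \<noteq> t"
    then obtain q' p' where v: "(q', p') \<in> markov_pairs" and sv: "s = real_of_int p' / real_of_int (p' + q')"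
      using rat_obtain_markov_pair[of s] by auto
    have pos: "0 < real_of_int p' + real_of_int q'" using v by (auto simp: markov_pairs_def)
    have "\<alpha> * q' + \<beta> * p' < markov_length q' p'" using s(2) by (intro ab(2) v) (auto simp: sv tw)
    then have "(\<alpha> * q' + \<beta> * p') / (p' + q') < fock s"
      using pos unfolding sv fock_markov_pair[OF v] by (intro divide_strict_right_mono) auto
    then have "\<alpha> + (\<beta> - \<alpha>) * s < fock s" using line[OF pos] by (simp add: sv)
    then show "fock t + (\<beta> - \<alpha>) * (s - t) < fock s" by (simp add: ft algebra_simps)
  qed
qed

section \<open>From subgradients to the Markov order\<close>

lemma markov_less_iff:
  assumes "(q, p) \<in> markov_pairs" "(q', p') \<in> markov_pairs"
  shows "(q, p) \<prec>\<^sub>M (q', p') \<longleftrightarrow> markov_length q p < markov_length q' p'"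
  using markov_pos[OF assms(1)] markov_pos[OF assms(2)]
  by (auto simp: markov_less_def markov_length_def)

text \<open>Arises by clearing denominators in the strict inequality at \<open>p'/(p' + q')\<close>;
  the products \<open>p * p'\<close> cancel in the coefficient of \<open>D\<close>.\<close>

lemma subgradient_inequality:
  assumes w: "(q, p) \<in> markov_pairs" "2 \<le> q" and v: "(q', p') \<in> markov_pairs" "(q', p') \<noteq> (q, p)"
    and D: "D = right_deriv fock (real_of_int p / real_of_int (p + q)) \<or> D = left_deriv fock (real_of_int p / real_of_int (p + q))"
  shows "real_of_int (p' + q') * markov_length q p + D * real_of_int (p' * q - p * q')
    < real_of_int (p + q) * markov_length q' p'"
proof -
  have p: "1 \<le> p" "p < q" using markov_pairs_interior[OF w] by auto
  have p': "0 \<le> p'" "p' \<le> q'" "1 \<le> q'" "coprime q' p'" using v by (auto simp: markov_pairs_def)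
  define t where "t = real_of_int p / real_of_int (p + q)"
  define s where "s = real_of_int p' / real_of_int (p' + q')"
  have "s \<noteq> t"
  proof
    assume "s = t"
    then have "real_of_int (p' * (p + q)) = real_of_int (p * (p' + q'))"
      using p p' by (simp add: s_def t_def field_simps)
    then have "p' * (p + q) = p * (p' + q')" by (simp only: of_int_eq_iff)
    then have "p' * q = p * q'" by (simp add: algebra_simps)
    moreover have "coprime q p" using w by (simp add: markov_pairs_def)
    ultimately have "\<bar>p'\<bar> = \<bar>p\<bar> \<and> \<bar>q\<bar> = \<bar>q'\<bar>"
      using p'(4) coprime_crossproduct_int[of p' q' p q] by (simp add: coprime_commute flip: abs_mult)
    then show False using v(2) p p' by auto
  qed
  moreover have "s \<in> \<rat>" "t \<in> \<rat>" by (simp_all add: s_def t_def)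
  ultimately have "fock t + D * (s - t) < fock s"
    using p p' D by (intro fock_one_sided_derivatives rat_support_fock) (auto simp: s_def t_def field_simps)
  then have "markov_length q p / real_of_int (p + q) + D * (s - t) < markov_length q' p' / real_of_int (p' + q')"
    unfolding s_def t_def fock_markov_pair[OF w(1)] fock_markov_pair[OF v(1)] .
  moreover have "n' * l + D * (x * n - y * n') < n * m"
    if "l / n + D * (x / n' - y / n) < m / n'" "0 < n" "0 < n'" for l m n n' x y :: real
  proof -
    have "(l / n + D * (x / n' - y / n)) * (n * n') < m / n' * (n * n')"
      using that by (intro mult_strict_right_mono) auto
    moreover have "(l / n + D * (x / n' - y / n)) * (n * n') = n' * l + D * (x * n - y * n')"
      using that(2,3) by (simp add: field_simps)
    ultimately show ?thesis using that(3) by (simp add: mult.commute)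
  qed
  from this[of "markov_length q p" "real_of_int (p + q)" "real_of_int p'" "real_of_int (p' + q')"
      "real_of_int p" "markov_length q' p'"]
  have "real_of_int (p' + q') * markov_length q p
      + D * (real_of_int p' * real_of_int (p + q) - real_of_int p * real_of_int (p' + q'))
      < real_of_int (p + q) * markov_length q' p'"
    using calculation p p' by (simp only: s_def t_def)
  then show ?thesis by (simp add: algebra_simps)
qed

lemma markov_length_1_0: "markov_length 1 0 = arcosh (3 / 2)" "(1, 0) \<in> markov_pairs"
  by (simp_all add: markov_length_def markov_eqI[OF markov_rel.zero] markov_pairs_def)

text \<open>
  If the sign were wrong, the tangent form at \<open>(q, p)\<close> would not increase with \<open>p\<close>, so its value at
  \<open>(q, 0)\<close> would be at least the length of \<open>(q, p)\<close>, which exceeds \<open>q\<close> times the length of \<open>(1, 0)\<close>.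
\<close>

lemma tangent_slope_denominator_pos:
  assumes w: "(q, p) \<in> markov_pairs" "2 \<le> q"
    and D: "D = right_deriv fock (real_of_int p / real_of_int (p + q)) \<or> D = left_deriv fock (real_of_int p / real_of_int (p + q))"
  shows "0 < markov_length q p + D * q"
proof (rule ccontr)
  define l where "l = markov_length q p"
  have p: "1 \<le> p" using markov_pairs_interior[OF w] by auto
  assume "\<not> 0 < markov_length q p + D * q"
  then have "p * (l + D * q) \<le> 0" using p by (intro mult_nonneg_nonpos) (auto simp: l_def)
  \<comment> \<open>\<open>(p + q) * l\<close> splits as
    \<open>q * (l - D * p) + p * (l + D * q)\<close>.\<close>
  then have "(p + q) * l \<le> q * (l - D * p)" by (simp add: algebra_simps)
  \<comment> \<open>The subgradient inequality at \<open>(1, 0)\<close> bounds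
    \<open>l - D * p\<close>.\<close>
  moreover have "q * (l - D * p) < q * ((p + q) * arcosh (3 / 2))"
    using subgradient_inequality[OF w markov_length_1_0(2) _ D] w(2)
    by (intro mult_strict_left_mono) (auto simp: markov_length_1_0(1) l_def)
  moreover have "q * ((p + q) * arcosh (3 / 2)) < (p + q) * l"
    using markov_length_lower_bound[OF w(1)] p w(2) by (simp add: l_def mult.commute mult.left_commute)
  ultimately show False by linarith
qed

text \<open>The expression in \<open>side\<close> is the left side of
  \<open>subgradient_inequality\<close> minus \<open>p + q\<close> times the length of
  \<open>(q, p)\<close>: the tangent form does not drop from \<open>(q, p)\<close> to
  \<open>(q', p')\<close>.\<close>

lemma markov_less_of_tangent_slope:
  assumes w: "(q, p) \<in> markov_pairs" "2 \<le> q" and v: "(q', p') \<in> markov_pairs" "(q', p') \<noteq> (q, p)"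
    and D: "D = right_deriv fock (real_of_int p / real_of_int (p + q)) \<or> D = left_deriv fock (real_of_int p / real_of_int (p + q))"
    and side: "0 \<le> (p' - p) * (markov_length q p + D * q) + (q' - q) * (markov_length q p - D * p)"
  shows "(q, p) \<prec>\<^sub>M (q', p')"
proof -
  have "real_of_int (p + q) * markov_length q p
      \<le> real_of_int (p' + q') * markov_length q p + D * real_of_int (p' * q - p * q')"
    using side by (simp add: algebra_simps)
  also have "\<dots> < real_of_int (p + q) * markov_length q' p'" 
    using subgradient_inequality[OF w v D] by simp
  finally show ?thesis
    using w v markov_pairs_interior[OF w] by (simp add: markov_less_iff)
qed

text \<open>Denominator 1 belongs to the ends of the domain of \<open>fock\<close>, beyond the
  interior support lines. Such lengths are at most \<open>2 * l\<close>, and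
  \<open>q' \<ge> 2\<close> pushes the other one above that.\<close>

lemma markov_less_of_denominator_1:
  assumes w: "(1, p) \<in> markov_pairs" and v: "(q', p') \<in> markov_pairs" "1 < q'"
  shows "(1, p) \<prec>\<^sub>M (q', p')"
proof -
  have p': "1 \<le> p'" using markov_pairs_interior[OF v(1)] v by simp
  define l :: real where "l = arcosh (3 / 2)"
  have l: "0 < l" "cosh l = 3 / 2" by (simp_all add: l_def)
  have "markov_length 1 p \<le> 2 * l"
  proof -
    have "p = 0 \<or> p = 1" using w by (auto simp: markov_pairs_def)
    then show ?thesis
    proof
      assume "p = 1"
      have "cosh (arcosh 3) \<le> cosh (2 * l)"
        unfolding cosh_double_cosh l by (simp add: power_divide)
      then have "arcosh 3 \<le> 2 * l" using l by (subst (asm) cosh_real_nonneg_le_iff) auto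
      then show ?thesis using \<open>p = 1\<close> by (simp add: markov_length_def markov_eqI[OF markov_rel.one])
    qed (use l in \<open>simp add: markov_length_1_0 flip: l_def\<close>)
  qed
  also have "\<dots> \<le> l * q'" using l v by simp
  also have "\<dots> < markov_length q' p'"
    using markov_length_lower_bound[OF v(1)] p' by (simp add: l_def)
  finally show ?thesis using w v by (simp add: markov_less_iff)
qed

text \<open>Here \<open>d\<close> and \<open>e\<close> stand for the increments of \<open>q\<close>
  and \<open>p\<close>, and \<open>N / P\<close> for the quotient in \<open>mu_plus\<close>.\<close>

lemma slope_le_iff:
  fixes d e N P :: real
  assumes "d < 0" "0 < P"
  shows "e / d \<le> - (N / P) \<longleftrightarrow> 0 \<le> e * P + d * N"
proof -
  have "e / d \<le> - (N / P) \<longleftrightarrow> - (d * N) / P \<le> e" using assms by (simp add: neg_divide_le_eq mult.commute)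
  also have "\<dots> \<longleftrightarrow> - (d * N) \<le> e * P" using assms(2) by (rule pos_divide_le_eq)
  finally show ?thesis by linarith
qed

lemma slope_ge_iff:
  fixes d e N P :: real
  assumes "0 < d" "0 < P"
  shows "- (N / P) \<le> e / d \<longleftrightarrow> 0 \<le> e * P + d * N"
proof -
  have "- (N / P) \<le> e / d \<longleftrightarrow> - (d * N) / P \<le> e" using assms by (simp add: pos_le_divide_eq mult.commute)
  also have "\<dots> \<longleftrightarrow> - (d * N) \<le> e * P" using assms(2) by (rule pos_divide_le_eq)
  finally show ?thesis by linarith
qed

theorem theorem1p2:
  fixes q p q' p' :: int
  assumes "(q, p) \<in> markov_pairs" and "(q', p') \<in> markov_pairs" and "p' \<noteq> p"
  shows "(q' < q \<and> real_of_int (p' - p) / real_of_int (q' - q) \<le> mu_plus p q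
            \<longrightarrow> (q, p) \<prec>\<^sub>M (q', p'))
       \<and> (q' > q \<and> real_of_int (p' - p) / real_of_int (q' - q) \<ge> mu_minus p q
            \<longrightarrow> (q, p) \<prec>\<^sub>M (q', p'))"
proof (cases "q = 1")
  case True
  \<comment> \<open>No pair has denominator below 1, so the second claim remains.\<close>
  have "\<not> q' < q" using True assms(2) by (auto simp: markov_pairs_def)
  then show ?thesis using markov_less_of_denominator_1[of p q' p'] assms True by auto
next
  case False
  then have q: "2 \<le> q" using assms(1) by (auto simp: markov_pairs_def)
  define t where "t = real_of_int p / real_of_int (p + q)"
  define l where "l = markov_length q p"
  have mu: "mu_plus p q = - ((l - right_deriv fock t * p) / (l + right_deriv fock t * q))"
    "mu_minus p q = - ((l - left_deriv fock t * p) / (l + left_deriv fock t * q))"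
    by (simp_all add: mu_plus_def mu_minus_def Let_def l_def t_def markov_length_def)
  have less: "(q, p) \<prec>\<^sub>M (q', p')"
    if "D = right_deriv fock t \<or> D = left_deriv fock t"
      "0 \<le> (p' - p) * (l + D * q) + (q' - q) * (l - D * p)" for D :: real
    using markov_less_of_tangent_slope[OF assms(1) q assms(2), of D] that assms(3)
    by (simp add: t_def l_def)
  \<comment> \<open>Positivity permits clearing the denominators of both slopes.\<close>
  have pos: "0 < l + D * q" if "D = right_deriv fock t \<or> D = left_deriv fock t" for D :: real
    using tangent_slope_denominator_pos[OF assms(1) q, of D] that by (simp add: t_def l_def)
  show ?thesis
  proof (intro conjI impI; elim conjE)
    assume "q' < q" "real_of_int (p' - p) / real_of_int (q' - q) \<le> mu_plus p q"
    then show "(q, p) \<prec>\<^sub>M (q', p')"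
      using slope_le_iff[of "real_of_int (q' - q)"] pos[of "right_deriv fock t"] less[of "right_deriv fock t"]
      by (simp add: mu)
  next
    assume "q < q'" "real_of_int (p' - p) / real_of_int (q' - q) \<ge> mu_minus p q"
    then show "(q, p) \<prec>\<^sub>M (q', p')"
      using slope_ge_iff[of "real_of_int (q' - q)"] pos[of "left_deriv fock t"] less[of "left_deriv fock t"]
      by (simp add: mu)
  qed
qed

end
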